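(* For every positive integer $n$, the virtual cactus group $vC_n$ is $\mathbb{Z}$-linear.
   Context: Let $[n]=\{1,\dots,n\}$ and $[i,j]=\{i,i+1,\dots,j\}$ for $i<j$. Let $w_{ij}\in S_n$ be the permutation that reverses the interval $[i,j]$ and fixes all elements outside it. The cactus group $C_n$ is generated by $\{s_{ij}\mid 1\le i<j\le n\}$ with relations, for all $i<j$, $k<l$: (1) $s_{ij}^2=1$; (2) $s_{ij}s_{kl}=s_{kl}s_{ij}$ if $[i,j]\cap[k,l]=\varnothing$; (3) $s_{ij}s_{kl}=s_{w_{ij}(l)\,w_{ij}(k)}s_{ij}$ if $[k,l]\subset[i,j]$. The virtual cactus group $vC_n$ is the quotient of the free product $C_n*S_n$ by the relations $ws_{ij}w^{-1}=s_{w(i)w(j)}$ for all $1\le i<j\le n$ and all $w\in S_n$ such that $w(i+k)=w(i)+k$ for $k=0,\dots,j-i$. A group is $\mathbb Z$-linear if it is isomorphic to a subgroup of $\mathrm{GL}_m(\mathbb Z)$ for some positive integer $m$. *)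

theory Defs
  imports "HOL-Algebra.Sym_Groups" "Jordan_Normal_Form.Matrix"
begin

inductive_set word_cong :: "'a set \<Rightarrow> ('a list \<times> 'a list) set \<Rightarrow> ('a list \<times> 'a list) set"
  for A :: "'a set" and R :: "('a list \<times> 'a list) set" where
  refl: "u \<in> lists A \<Longrightarrow> (u, u) \<in> word_cong A R"
| sym: "(u, v) \<in> word_cong A R \<Longrightarrow> (v, u) \<in> word_cong A R"
| trans: "(u, v) \<in> word_cong A R \<Longrightarrow> (v, w) \<in> word_cong A R \<Longrightarrow> (u, w) \<in> word_cong A R"
| rewrite: "(l, r) \<in> R \<Longrightarrow> l \<in> lists A \<Longrightarrow> r \<in> lists A \<Longrightarrow> p \<in> lists A \<Longrightarrow> q \<in> lists A
    \<Longrightarrow> (p @ l @ q, p @ r @ q) \<in> word_cong A R"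

definition word_class :: "'a set \<Rightarrow> ('a list \<times> 'a list) set \<Rightarrow> 'a list \<Rightarrow> 'a list set" where
  "word_class A R u = word_cong A R `` {u}"

definition word_quotient :: "'a set \<Rightarrow> ('a list \<times> 'a list) set \<Rightarrow> 'a list set monoid" where
  "word_quotient A R =
    \<lparr>carrier = lists A // word_cong A R,
     mult = (\<lambda>U V. \<Union>u\<in>U. \<Union>v\<in>V. word_class A R (u @ v)),
     one = word_class A R []\<rparr>"

text \<open>In the alphabet of the free group, \<open>(x, True)\<close> stands for \<open>x\<close> and
  \<open>(x, False)\<close> for its inverse.\<close>

definition free_group_rules :: "('a \<times> bool) list rel" where
  "free_group_rules = {([(x, b), (x, \<not> b)], []) | x b. True}"

definition free_group :: "'a set \<Rightarrow> ('a \<times> bool) list set monoid" where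
  "free_group X = word_quotient (X \<times> UNIV) free_group_rules"

definition free_gen :: "'a set \<Rightarrow> 'a \<Rightarrow> ('a \<times> bool) list set" where
  "free_gen X x = word_class (X \<times> UNIV) free_group_rules [(x, True)]"

definition free_product_rules ::
  "('a, 'c) monoid_scheme \<Rightarrow> ('b, 'd) monoid_scheme \<Rightarrow> ('a + 'b) list rel" where
  "free_product_rules G H =
     {([Inl x, Inl y], [Inl (x \<otimes>\<^bsub>G\<^esub> y)]) | x y. x \<in> carrier G \<and> y \<in> carrier G}
   \<union> {([Inr x, Inr y], [Inr (x \<otimes>\<^bsub>H\<^esub> y)]) | x y. x \<in> carrier H \<and> y \<in> carrier H}
   \<union> {([Inl \<one>\<^bsub>G\<^esub>], []), ([Inr \<one>\<^bsub>H\<^esub>], [])}"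

definition free_product ::
  "('a, 'c) monoid_scheme \<Rightarrow> ('b, 'd) monoid_scheme \<Rightarrow> ('a + 'b) list set monoid" where
  "free_product G H = word_quotient (carrier G <+> carrier H) (free_product_rules G H)"

definition free_product_inl ::
  "('a, 'c) monoid_scheme \<Rightarrow> ('b, 'd) monoid_scheme \<Rightarrow> 'a \<Rightarrow> ('a + 'b) list set" where
  "free_product_inl G H x = word_class (carrier G <+> carrier H) (free_product_rules G H) [Inl x]"

definition free_product_inr ::
  "('a, 'c) monoid_scheme \<Rightarrow> ('b, 'd) monoid_scheme \<Rightarrow> 'b \<Rightarrow> ('a + 'b) list set" where
  "free_product_inr G H y = word_class (carrier G <+> carrier H) (free_product_rules G H) [Inr y]"

definition normal_closure :: "('a, 'b) monoid_scheme \<Rightarrow> 'a set \<Rightarrow> 'a set" where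
  "normal_closure G S = \<Inter>{N. N \<lhd> G \<and> S \<subseteq> N}"

text \<open>A pair \<open>(u, v) \<in> E\<close> encodes the relation \<open>u = v\<close>.\<close>

definition relators :: "('a, 'b) monoid_scheme \<Rightarrow> ('a \<times> 'a) set \<Rightarrow> 'a set" where
  "relators G E = {u \<otimes>\<^bsub>G\<^esub> inv\<^bsub>G\<^esub> v | u v. (u, v) \<in> E}"

definition impose :: "('a, 'b) monoid_scheme \<Rightarrow> ('a \<times> 'a) set \<Rightarrow> 'a set monoid" where
  "impose G E = G Mod normal_closure G (relators G E)"

definition impose_proj :: "('a, 'b) monoid_scheme \<Rightarrow> ('a \<times> 'a) set \<Rightarrow> 'a \<Rightarrow> 'a set" where
  "impose_proj G E x = normal_closure G (relators G E) #>\<^bsub>G\<^esub> x"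

definition interval_reversal :: "nat \<Rightarrow> nat \<Rightarrow> nat \<Rightarrow> nat" where
  "interval_reversal i j k = (if i \<le> k \<and> k \<le> j then i + j - k else k)"

definition cactus_index :: "nat \<Rightarrow> (nat \<times> nat) set" where
  "cactus_index n = {(i, j). 1 \<le> i \<and> i < j \<and> j \<le> n}"

abbreviation cactus_free :: "nat \<Rightarrow> ((nat \<times> nat) \<times> bool) list set monoid" where
  "cactus_free n \<equiv> free_group (cactus_index n)"

abbreviation cactus_letter :: "nat \<Rightarrow> nat \<Rightarrow> nat \<Rightarrow> ((nat \<times> nat) \<times> bool) list set" where
  "cactus_letter n i j \<equiv> free_gen (cactus_index n) (i, j)"

text \<open>The last family allows \<open>[k, l] = [i, j]\<close>, where the relation is trivial.\<close>

definition cactus_relations :: "nat \<Rightarrow> ((nat \<times> nat) \<times> bool) list set rel" where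
  "cactus_relations n =
     {(cactus_letter n i j \<otimes>\<^bsub>cactus_free n\<^esub> cactus_letter n i j, \<one>\<^bsub>cactus_free n\<^esub>)
        | i j. (i, j) \<in> cactus_index n}
   \<union> {(cactus_letter n i j \<otimes>\<^bsub>cactus_free n\<^esub> cactus_letter n k l,
       cactus_letter n k l \<otimes>\<^bsub>cactus_free n\<^esub> cactus_letter n i j)
        | i j k l. (i, j) \<in> cactus_index n \<and> (k, l) \<in> cactus_index n
                 \<and> {i..j} \<inter> {k..l} = {}}
   \<union> {(cactus_letter n i j \<otimes>\<^bsub>cactus_free n\<^esub> cactus_letter n k l,
       cactus_letter n (interval_reversal i j l) (interval_reversal i j k)
         \<otimes>\<^bsub>cactus_free n\<^esub> cactus_letter n i j)
        | i j k l. (i, j) \<in> cactus_index n \<and> (k, l) \<in> cactus_index n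
                 \<and> {k..l} \<subseteq> {i..j}}"

definition cactus_group :: "nat \<Rightarrow> ((nat \<times> nat) \<times> bool) list set set monoid" where
  "cactus_group n = impose (cactus_free n) (cactus_relations n)"

definition cactus_gen :: "nat \<Rightarrow> nat \<Rightarrow> nat \<Rightarrow> ((nat \<times> nat) \<times> bool) list set set" where
  "cactus_gen n i j = impose_proj (cactus_free n) (cactus_relations n) (cactus_letter n i j)"

type_synonym cactus_perm_word =
  "(((nat \<times> nat) \<times> bool) list set set + (nat \<Rightarrow> nat)) list set"

definition cactus_perm :: "nat \<Rightarrow> cactus_perm_word monoid" where
  "cactus_perm n = free_product (cactus_group n) (sym_group n)"

definition cactus_perm_gen :: "nat \<Rightarrow> nat \<Rightarrow> nat \<Rightarrow> cactus_perm_word" where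
  "cactus_perm_gen n i j = free_product_inl (cactus_group n) (sym_group n) (cactus_gen n i j)"

definition cactus_perm_perm :: "nat \<Rightarrow> (nat \<Rightarrow> nat) \<Rightarrow> cactus_perm_word" where
  "cactus_perm_perm n w = free_product_inr (cactus_group n) (sym_group n) w"

text \<open>The product of \<open>sym_group n\<close> is composition of functions, so permutations act from the
  left, as the form \<open>w s(i,j) w\<^sup>-\<^sup>1 = s(w(i),w(j))\<close> of the relation requires.\<close>

definition virtual_cactus_relations :: "nat \<Rightarrow> cactus_perm_word rel" where
  "virtual_cactus_relations n =
     {(cactus_perm_perm n w \<otimes>\<^bsub>cactus_perm n\<^esub> cactus_perm_gen n i j
         \<otimes>\<^bsub>cactus_perm n\<^esub> inv\<^bsub>cactus_perm n\<^esub> (cactus_perm_perm n w),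
       cactus_perm_gen n (w i) (w j))
        | w i j. (i, j) \<in> cactus_index n \<and> w \<in> carrier (sym_group n)
               \<and> (\<forall>k\<in>{0..j - i}. w (i + k) = w i + k)}"

definition virtual_cactus_group :: "nat \<Rightarrow> cactus_perm_word set monoid" where
  "virtual_cactus_group n = impose (cactus_perm n) (virtual_cactus_relations n)"

definition GL_int :: "nat \<Rightarrow> int mat monoid" where
  "GL_int m = units_of (ring_mat TYPE(int) m ())"

definition Z_linear :: "('a, 'b) monoid_scheme \<Rightarrow> bool" where
  "Z_linear G \<longleftrightarrow> group G \<and>
     (\<exists>m\<ge>1. \<exists>K. subgroup K (GL_int m) \<and> G \<cong> (GL_int m)\<lparr>carrier := K\<rparr>)"

end

theory Submission
  imports Defs "HOL-Library.Sublist"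
begin

text \<open>Write \<open>s\<^sub>a = w s\<^bsub>1k\<^esub> w\<^sup>-\<^sup>1\<close> for an injective tuple \<open>a = (w 1, \<dots>, w k)\<close>; every element of \<open>vC\<^sub>n\<close> is a
  product of such involutions followed by a permutation. Moving \<open>s\<^sub>a\<close> past \<open>s\<^sub>b\<close>, for \<open>b\<close> a contiguous
  block of \<open>a\<close>, replaces \<open>b\<close> by its mirror image inside \<open>a\<close>. The tuple \<open>a\<close>, together with the set of
  its blocks and its support, transported to the start of a word by mirror images and letter
  reversals, is a label that such moves preserve, and two adjacent letters can be swapped exactly
  if their labels are commuting vertices of a fixed finite graph. So \<open>vC\<^sub>n\<close> acts on integer vectors
  indexed by labels as a subgroup of (right-angled Coxeter group) \<open>\<rtimes>\<close> (finite group), where the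
  Coxeter group acts by the dual of its geometric representation. Starting from the all-ones
  vector, the sign pattern after a word without cancellation shows its first letters, so only the
  trivial element acts trivially.\<close>

subsection \<open>The numbers game of a right-angled Coxeter group\<close>

text \<open>The obstacle is that mirror images do not preserve the relation "disjoint or block"
  between tuples. If \<open>b\<close> is a block of both \<open>a\<close> and \<open>c\<close>, and
  \<open>a\<close> is not a block of \<open>c\<close>, then \<open>mirror c\<close> fixes
  \<open>a\<close> and may move \<open>b\<close> out of \<open>a\<close>: take
  \<open>c = [1,2,3,4]\<close>, \<open>b = [1,2]\<close>, \<open>a = [1,2,5]\<close>. So the
  commutation graph is built on a larger vertex set, where blocks and support are independent data,
  each moved as a set by a bijection, and invariance becomes automatic. The price is that a
  transported label need not be the label of any tuple, while a relation of the group can be applied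
  only to tuples. What bridges the gap is that commutation with the letters in front forces a
  transported label to be genuine again, so that every cancellation seen in the label word can be
  carried out in the group itself. The all-ones vector cannot see the permutation at the end of a
  word; that one is detected by extra labels which carry nothing but a support.\<close>

locale numbers_game =
  fixes comm :: "'l \<Rightarrow> 'l \<Rightarrow> bool"
  assumes comm_sym: "comm a b \<Longrightarrow> comm b a"
begin

text \<open>Read \<open>v b\<close> as the value of a functional on the simple root of
  \<open>b\<close>. Distinct noncommuting generators have a product of infinite order, so the form
  takes the value -1 on their roots and the reflection at \<open>a\<close> adds twice the root of
  \<open>a\<close>; hence the factor 2. The case \<open>b = a\<close> comes first because
  \<open>comm a a\<close> may hold, as it does for labels of tuples.\<close>

definition fire :: "'l \<Rightarrow> ('l \<Rightarrow> int) \<Rightarrow> 'l \<Rightarrow> int" where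
  "fire a v = (\<lambda>b. if b = a then - v a else if comm a b then v b else v b + 2 * v a)"

lemma fire_fire: "fire a (fire a v) = v"
  by (auto simp: fire_def fun_eq_iff)

lemma fire_commute: "comm a b \<Longrightarrow> fire a (fire b v) = fire b (fire a v)"
  using comm_sym[of a b] by (auto simp: fire_def fun_eq_iff)

lemma fire_comp:
  assumes "inj g" and "\<And>x y. comm (g x) (g y) = comm x y"
  shows "fire (g a) v \<circ> g = fire a (v \<circ> g)"
  using assms by (auto simp: fire_def fun_eq_iff inj_eq)

definition play :: "'l list \<Rightarrow> 'l \<Rightarrow> int" where
  "play w = foldr fire w (\<lambda>_. 1)"

lemma play_simps [simp]: "play [] = (\<lambda>_. 1)" "play (a # w) = fire a (play w)"
  by (simp_all add: play_def)

text \<open>The all-ones vector is invariant under \<open>g\<close>, so an automorphism of the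
  commutation graph only renames the letters. Pulling back along \<open>g\<close> renames by the
  inverse of \<open>g\<close>, which is \<open>g\<close> itself for an involution.\<close>

lemma play_map:
  assumes invol: "\<And>x. g (g x) = x" and "\<And>x y. comm (g x) (g y) = comm x y"
  shows "play w \<circ> g = play (map g w)"
proof (induction w)
  case (Cons a w)
  have "inj g" using invol by (rule inj_on_inverseI)
  then show ?case
    using fire_comp[of g "g a" "play w"] assms Cons.IH by simp
qed (simp add: comp_def)

text \<open>The letters with an occurrence that commutations can move to the front; for a reduced
  word this is the left descent set.\<close>

fun desc :: "'l list \<Rightarrow> 'l set" where
  "desc [] = {}"
| "desc (a # w) = insert a {b \<in> desc w. comm a b}"

fun reduced :: "'l list \<Rightarrow> bool" where
  "reduced [] \<longleftrightarrow> True"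
| "reduced (a # w) \<longleftrightarrow> a \<notin> desc w \<and> reduced w"

text \<open>The last conjunct is there for the induction: firing \<open>c\<close> makes the negative value at a
  noncommuting \<open>b\<close> positive again.\<close>

lemma reduced_play:
  assumes "reduced w"
  shows "(\<forall>b. b \<notin> desc w \<longrightarrow> play w b > 0) \<and> (\<forall>b\<in>desc w. play w b < 0) \<and>
    (\<forall>b\<in>desc w. \<forall>c. c \<noteq> b \<longrightarrow> \<not> comm b c \<longrightarrow> play w b + play w c \<ge> 0)"
  using assms
proof (induction w)
  case (Cons a w)
  let ?v = "play w" and ?v' = "play (a # w)"
  have a: "a \<notin> desc w" and IH: "\<And>b. b \<notin> desc w \<Longrightarrow> ?v b > 0" "\<And>b. b \<in> desc w \<Longrightarrow> ?v b < 0"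
    "\<And>b c. b \<in> desc w \<Longrightarrow> c \<noteq> b \<Longrightarrow> \<not> comm b c \<Longrightarrow> ?v b + ?v c \<ge> 0"
    using Cons by auto
  have pos: "?v a > 0" using IH(1) a .
  have v': "?v' b = (if b = a then - ?v a else if comm a b then ?v b else ?v b + 2 * ?v a)" for b
    by (simp add: fire_def)
  note [simp del] = play_simps
  \<comment> \<open>Either \<open>?v c > 0\<close>, or \<open>c\<close> is in \<open>desc w\<close>
    and the third induction hypothesis applies to the pair \<open>c\<close>, \<open>a\<close>. The
    bound serves twice: it gives \<open>?v c + 2 * ?v a > 0\<close> after firing, and it is the
    third claim for \<open>b = a\<close>, because
    \<open>- ?v a + (?v c + 2 * ?v a) = ?v c + ?v a\<close>.\<close>
  have far: "?v c + ?v a \<ge> 0" if "c \<noteq> a" "\<not> comm a c" for c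
    using that IH(1)[of c] IH(3)[of c a] pos comm_sym by fastforce
  have "?v' b > 0" if "b \<notin> desc (a # w)" for b
    using that IH(1)[of b] far[of b] pos by (auto simp: v')
  moreover have "?v' b < 0" if "b \<in> desc (a # w)" for b
    using that IH(2)[of b] pos by (auto simp: v')
  moreover have "?v' b + ?v' c \<ge> 0" if "b \<in> desc (a # w)" "c \<noteq> b" "\<not> comm b c" for b c
  proof (cases "b = a")
    case True
    then show ?thesis using that far[of c] by (auto simp: v')
  next
    case False
    then have b: "b \<in> desc w" "comm a b" using that(1) by auto
    then have "c \<noteq> a" using that(3) comm_sym by auto
    \<comment> \<open>Firing \<open>a\<close> with \<open>?v a > 0\<close> lowers no value except
      the one at \<open>a\<close>.\<close>
    then have "?v' c \<ge> ?v c" "?v' b = ?v b" using b False pos by (auto simp: v')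
    then show ?thesis using IH(3)[OF b(1) that(2,3)] by linarith
  qed
  ultimately show ?case by blast
qed auto

lemma hd_of_play_one:
  assumes "reduced (a # w)"
  shows "play (a # w) a \<noteq> 1"
  using reduced_play[OF assms] by force

lemma desc_split:
  "b \<in> desc w \<Longrightarrow> \<exists>vs ws. w = vs @ b # ws \<and> (\<forall>c\<in>set vs. comm b c)"
proof (induction w)
  case (Cons a w)
  show ?case
  proof (cases "b = a")
    case True
    then show ?thesis by (intro exI[of _ "[]"] exI[of _ w]) auto
  next
    case False
    then obtain vs ws where "w = vs @ b # ws" "\<forall>c\<in>set vs. comm b c" using Cons by auto
    then show ?thesis using False Cons.prems comm_sym
      by (intro exI[of _ "a # vs"] exI[of _ ws]) auto
  qed
qed auto

text \<open>The second \<open>b\<close> can be commuted back to the first, where the two cancel.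
  This is the only kind of cancellation that has to be lifted to the group later.\<close>

lemma not_reduced_split:
  "\<not> reduced w \<Longrightarrow> \<exists>us b vs ws. w = us @ b # vs @ b # ws \<and> (\<forall>c\<in>set vs. comm b c)"
proof (induction w)
  case (Cons a w)
  show ?case
  proof (cases "a \<in> desc w")
    case True
    then show ?thesis using desc_split[of a w] by (metis append_Nil)
  next
    case False
    then obtain us b vs ws where "w = us @ b # vs @ b # ws" "\<forall>c\<in>set vs. comm b c"
      using Cons by auto
    then show ?thesis by (metis append_Cons)
  qed
qed auto

end

subsection \<open>Tuples, mirror images and labels\<close>

text \<open>For distinct \<open>a\<close>, the conjugate of
  \<open>interval_reversal 1 (length a)\<close> by a permutation that carries 1, 2, ... to the
  entries of \<open>a\<close>. Distinctness makes the position found by \<open>map_of\<close>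
  unambiguous.\<close>

definition list_reversal :: "'a list \<Rightarrow> 'a \<Rightarrow> 'a" where
  "list_reversal a x = (case map_of (zip a (rev a)) x of None \<Rightarrow> x | Some y \<Rightarrow> y)"

lemma map_list_reversal: "distinct a \<Longrightarrow> map (list_reversal a) a = rev a"
  by (auto simp: list_reversal_def map_of_zip_nth intro!: nth_equalityI)

lemma list_reversal_notin: "x \<notin> set a \<Longrightarrow> list_reversal a x = x"
  by (auto simp: list_reversal_def split: option.split dest: map_of_SomeD set_zip_leftD)

lemma list_reversal_unique:
  assumes "distinct a" "map g a = rev a" "\<And>x. x \<notin> set a \<Longrightarrow> g x = x"
  shows "g = list_reversal a"
proof
  fix x
  show "g x = list_reversal a x"
  proof (cases "x \<in> set a")
    case True
    then show ?thesis using assms(2) map_list_reversal[OF assms(1)] by (metis map_eq_conv)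
  qed (simp add: assms(3) list_reversal_notin)
qed

lemma map_list_reversal_rev: "distinct a \<Longrightarrow> map (list_reversal a) (rev a) = a"
  using map_list_reversal by (metis rev_map rev_rev_ident)

lemma list_reversal_invol: "distinct a \<Longrightarrow> list_reversal a (list_reversal a x) = x"
proof (cases "x \<in> set a")
  case True
  assume a: "distinct a"
  then have "map (\<lambda>x. list_reversal a (list_reversal a x)) a = map (\<lambda>x. x) a"
    using map_list_reversal map_list_reversal_rev by (metis (no_types) list.map_comp[unfolded comp_def] map_ident)
  with True show ?thesis using map_eq_conv by fastforce
qed (simp add: list_reversal_notin)

lemma map_list_reversal_invol: "distinct a \<Longrightarrow> map (list_reversal a) (map (list_reversal a) x) = x"
  by (simp add: list_reversal_invol map_idI)

lemma bij_list_reversal: "distinct a \<Longrightarrow> bij (list_reversal a)"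
  by (rule involuntory_imp_bij) (rule list_reversal_invol)

lemma list_reversal_in: "distinct a \<Longrightarrow> list_reversal a x \<in> set a \<longleftrightarrow> x \<in> set a"
  using list_reversal_invol list_reversal_notin by metis

lemma image_list_reversal: "distinct a \<Longrightarrow> set a \<subseteq> B \<Longrightarrow> list_reversal a ` B = B"
proof -
  assume a: "distinct a" "set a \<subseteq> B"
  then have "list_reversal a ` B \<subseteq> B" using list_reversal_in list_reversal_notin by (metis image_subsetI subsetD)
  moreover have "x \<in> list_reversal a ` B" if "x \<in> B" for x
    using that calculation list_reversal_invol[OF a(1)] by (metis image_eqI image_subset_iff)
  ultimately show ?thesis by blast
qed

lemma sublist_map_inj: "inj f \<Longrightarrow> sublist (map f b) (map f a) \<longleftrightarrow> sublist b a"
  using map_mono_sublist[of "map f b" "map f a" "inv_into UNIV f"] map_mono_sublist[of b a f]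
  by (auto simp: comp_def)

lemma sublist_antisym: "sublist a b \<Longrightarrow> sublist b a \<Longrightarrow> a = b"
  using sublist_order.order.antisym by blast

lemma sublist_distinct: "sublist b a \<Longrightarrow> distinct a \<Longrightarrow> distinct b"
  by (auto simp: sublist_def)

text \<open>The index that replaces \<open>b\<close> when the generator of \<open>b\<close> is
  passed by that of \<open>a\<close>. The outer \<open>rev\<close> restores the reading direction of
  \<open>a\<close>, so that blocks go to blocks. Fixing all other lists makes
  \<open>mirror a\<close> a total involution.\<close>

definition mirror :: "'a list \<Rightarrow> 'a list \<Rightarrow> 'a list" where
  "mirror a b = (if sublist b a then rev (map (list_reversal a) b) else b)"

lemma mirror_Nil [simp]: "mirror a [] = []"
  by (simp add: mirror_def)

lemma mirror_self: "distinct a \<Longrightarrow> mirror a a = a"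
  by (simp add: mirror_def map_list_reversal)

lemma sublist_rev_map_list_reversal:
  assumes "distinct a" "sublist b a"
  shows "sublist (rev (map (list_reversal a) b)) a"
proof -
  have "sublist (rev (map (list_reversal a) b)) (rev (map (list_reversal a) a))"
    using assms(2) by (simp add: map_mono_sublist)
  then show ?thesis using assms(1) by (simp add: map_list_reversal)
qed

lemma mirror_mirror:
  assumes "distinct a"
  shows "mirror a (mirror a b) = b"
  using sublist_rev_map_list_reversal[OF assms, of b] map_list_reversal_invol[OF assms]
  by (auto simp: mirror_def rev_map)

lemma sublist_mirror_iff:
  assumes "distinct a"
  shows "sublist (mirror a b) a \<longleftrightarrow> sublist b a"
  using sublist_rev_map_list_reversal[OF assms, of b] by (auto simp: mirror_def)

lemma mirror_mono:
  "sublist b a \<Longrightarrow> sublist c b \<Longrightarrow> sublist (mirror a c) (mirror a b)"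
  by (auto simp: mirror_def map_mono_sublist dest: sublist_order.order_trans)

lemma length_mirror [simp]: "length (mirror a b) = length b"
  by (simp add: mirror_def)

lemma list_reversal_map:
  assumes "inj f" "distinct a"
  shows "list_reversal (map f a) (f x) = f (list_reversal a x)"
proof (cases "x \<in> set a")
  case True
  have "map (list_reversal (map f a) \<circ> f) a = rev (map f a)"
    using map_list_reversal[of "map f a"] assms by (simp add: distinct_map inj_on_subset)
  also have "\<dots> = map (f \<circ> list_reversal a) a"
    using map_list_reversal[OF assms(2)] by (simp add: rev_map flip: map_map)
  finally show ?thesis using True by (auto simp: map_eq_conv)
next
  case False
  then show ?thesis using assms(1) by (simp add: list_reversal_notin inj_image_mem_iff)
qed

lemma mirror_map:
  assumes "inj f" "distinct a"
  shows "mirror (map f a) (map f b) = map f (mirror a b)"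
  using assms by (auto simp: mirror_def sublist_map_inj list_reversal_map rev_map)

text \<open>Reading a tuple backwards does not change which positions are exchanged. This absorbs
  the outer \<open>rev\<close> of \<open>mirror\<close> in the conjugation formula.\<close>

lemma list_reversal_rev: "distinct a \<Longrightarrow> list_reversal (rev a) = list_reversal a"
  using list_reversal_unique[of "rev a" "list_reversal a"]
  by (simp add: map_list_reversal_rev list_reversal_notin)

lemma list_reversal_conj:
  assumes "distinct c" "distinct b" "sublist b c"
  shows "list_reversal (mirror c b) (list_reversal c x) = list_reversal c (list_reversal b x)"
proof -
  have "inj (list_reversal c)" using bij_list_reversal[OF assms(1)] by (rule bij_is_inj)
  then show ?thesis
    using assms list_reversal_map[of "list_reversal c" b x]
    by (simp add: mirror_def list_reversal_rev distinct_map inj_on_subset)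
qed

text \<open>The nested cactus relation, read on the maps \<open>mirror\<close>. On blocks of
  \<open>b\<close> it is the conjugation formula for reversals. For any other \<open>d\<close> the
  maps belonging to \<open>b\<close> and to \<open>mirror c b\<close> both do nothing: were
  \<open>mirror c d\<close> a block of \<open>mirror c b\<close>, applying \<open>mirror c\<close>
  again would make \<open>d\<close> a block of \<open>b\<close>.\<close>

lemma mirror_conj:
  assumes c: "distinct c" and b: "sublist b c"
  shows "mirror (mirror c b) (mirror c d) = mirror c (mirror b d)"
proof -
  have db: "distinct b" using sublist_distinct[OF b c] .
  show ?thesis
  proof (cases "sublist d b")
    case True
    have "sublist (mirror b d) b" using sublist_mirror_iff[OF db] True by blast
    moreover have "sublist (mirror c d) (mirror c b)" using mirror_mono[OF b True] .
    moreover have "sublist d c" "sublist (mirror b d) c"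
      using True b calculation(1) sublist_order.order_trans by blast+
    ultimately have "mirror c (mirror b d) = map (list_reversal c \<circ> list_reversal b) d"
      "mirror (mirror c b) (mirror c d) = map (list_reversal (mirror c b) \<circ> list_reversal c) d"
      using True by (simp_all add: mirror_def[of _ "mirror _ d"])
        (simp_all add: mirror_def[of b d] mirror_def[of c d] True rev_map)
    then show ?thesis by (simp add: list_reversal_conj[OF c db b])
  next
    case False
    have "\<not> sublist (mirror c d) (mirror c b)"
    proof
      assume *: "sublist (mirror c d) (mirror c b)"
      have "sublist (mirror c b) c" using b sublist_mirror_iff[OF c] by blast
      from mirror_mono[OF this *] show False using False by (simp add: mirror_mirror c)
    qed
    then show ?thesis using False by (simp add: mirror_def[of b d] mirror_def[of "mirror c b"])
  qed
qed

lemma mirror_disjoint: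
  assumes "set a \<inter> set b = {}"
  shows "mirror a b = b"
\<comment> \<open>The empty list is a block of every list, so disjoint supports only exclude
  nonempty blocks.\<close>
proof (cases "b = []")
  case False
  then have "\<not> sublist b a" using assms set_mono_sublist[of b a] by (cases b) auto
  then show ?thesis by (simp add: mirror_def)
qed simp

lemma set_mirror_subset: "distinct b \<Longrightarrow> sublist d b \<Longrightarrow> set (mirror b d) \<subseteq> set b"
  using sublist_mirror_iff set_mono_sublist by blast

lemma list_reversal_disjoint:
  assumes "distinct a" "distinct b" "set a \<inter> set b = {}"
  shows "list_reversal a (list_reversal b x) = list_reversal b (list_reversal a x)"
  using assms list_reversal_in list_reversal_notin by (metis disjoint_iff)

text \<open>The image of a block of \<open>b\<close> stays inside \<open>set b\<close>, out of reach
  of \<open>mirror a\<close>, and symmetrically; all other lists are fixed by both maps.\<close>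

lemma mirror_commute_disjoint:
  assumes "distinct a" "distinct b" "set a \<inter> set b = {}"
  shows "mirror a (mirror b d) = mirror b (mirror a d)"
proof -
  have *: "mirror a (mirror b d) = mirror b (mirror a d)"
    if "distinct a" "distinct b" "set a \<inter> set b = {}" "sublist d b" for a b d :: "'a list"
  proof -
    have "mirror a (mirror b d) = mirror b d" "mirror a d = d"
      using that set_mirror_subset[of b d] set_mono_sublist[of d b] by (intro mirror_disjoint; blast)+
    then show ?thesis by simp
  qed
  show ?thesis
  proof (cases "sublist d a \<or> sublist d b")
    case True
    then show ?thesis using *[of a b d] *[of b a d] assms by (auto simp: Int_commute)
  qed (simp add: mirror_def)
qed

text \<open>The first component identifies a tuple, the second detects which tuples are blocks of it,
  and the third detects disjointness, which the first two do not preserve along a word.\<close>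

type_synonym label = "nat list \<times> nat list set \<times> nat set"

definition label :: "nat list \<Rightarrow> label" where
  "label a = (a, {b. sublist b a}, set a)"

fun label_comm :: "label \<Rightarrow> label \<Rightarrow> bool" where
  "label_comm (p, M, A) (q, N, B) \<longleftrightarrow> A \<inter> B = {} \<or> p \<in> N \<or> q \<in> M"

fun label_mirror :: "nat list \<Rightarrow> label \<Rightarrow> label" where
  "label_mirror a (p, M, A) = (mirror a p, mirror a ` M, list_reversal a ` A)"

fun label_map :: "(nat \<Rightarrow> nat) \<Rightarrow> label \<Rightarrow> label" where
  "label_map w (p, M, A) = (map w p, map w ` M, w ` A)"

interpretation numbers_game label_comm
  by unfold_locales auto

lemma label_comm_label:
  "label_comm (label a) (label b) \<longleftrightarrow> set a \<inter> set b = {} \<or> sublist a b \<or> sublist b a"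
  by (simp add: label_def)

lemma label_mirror_invol: "distinct a \<Longrightarrow> label_mirror a (label_mirror a x) = x"
  by (cases x) (simp add: mirror_mirror list_reversal_invol image_image)

text \<open>Membership and disjointness survive elementwise images under bijections, whatever the
  relation between \<open>a\<close> and the two labels. This is what is gained by moving the three
  components separately instead of recomputing blocks and support from the first.\<close>

lemma label_comm_mirror:
  assumes "distinct a"
  shows "label_comm (label_mirror a x) (label_mirror a y) = label_comm x y"
proof -
  have "inj (mirror a)" using mirror_mirror[OF assms] by (rule inj_on_inverseI)
  moreover have "inj (list_reversal a)" using bij_list_reversal[OF assms] by (rule bij_is_inj)
  ultimately show ?thesis
    by (cases x; cases y) (simp add: inj_image_mem_iff flip: image_Int)
qed

lemma label_comm_map: "bij w \<Longrightarrow> label_comm (label_map w x) (label_map w y) = label_comm x y"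
  by (cases x; cases y)
    (simp add: inj_image_mem_iff bij_is_inj inj_mapI flip: image_Int)

lemma label_map_label:
  assumes "bij w"
  shows "label_map w (label a) = label (map w a)"
proof -
  have "map w ` {b. sublist b a} = {b. sublist b (map w a)}"
    by (auto simp: map_mono_sublist dest!: sublist_map_rightE)
  then show ?thesis by (simp add: label_def)
qed

lemma label_map_mirror:
  assumes "bij w" "distinct a"
  shows "label_map w (label_mirror a x) = label_mirror (map w a) (label_map w x)"
  using assms by (cases x) (simp add: mirror_map list_reversal_map image_image bij_is_inj)

lemma label_map_comp: "label_map v (label_map w x) = label_map (v \<circ> w) x"
  by (cases x) (simp add: image_image)

lemma label_map_id [simp]: "label_map id = id"
  by (rule ext) (auto simp: fun_eq_iff)

text \<open>Commutation keeps a transported label genuine. If \<open>b\<close> is a block of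
  \<open>a\<close>, its blocks move along with it; if \<open>a\<close> is a block of
  \<open>b\<close>, the mirror permutes the blocks and the support of \<open>b\<close>; if the
  supports are disjoint, nothing moves.\<close>

lemma label_mirror_label:
  assumes a: "distinct a" and b: "distinct b" and ab: "label_comm (label a) (label b)"
  shows "label_mirror a (label b) = label (mirror a b)"
proof -
  consider "sublist b a" | "sublist a b" "\<not> sublist b a" | "set a \<inter> set b = {}" "\<not> sublist b a"
    using ab unfolding label_comm_label by blast
  then have "list_reversal a ` set b = set (mirror a b) \<and>
    (\<forall>d. sublist d b \<longrightarrow> sublist (mirror a d) (mirror a b)) \<and>
    (\<forall>d. sublist d (mirror a b) \<longrightarrow> sublist (mirror a d) b)"
  proof cases
    case 1
    then have "sublist (mirror a b) a" using sublist_mirror_iff[OF a] by blast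
    from mirror_mono[OF this] show ?thesis
      unfolding mirror_mirror[OF a] using 1 mirror_mono[OF 1] by (simp add: mirror_def)
  next
    case 2
    have "sublist (mirror a d) b" if "sublist d b" for d
      using that 2(1) sublist_mirror_iff[OF a] sublist_order.order_trans mirror_def by metis
    moreover have "mirror a b = b" using 2(2) by (simp add: mirror_def)
    ultimately show ?thesis using image_list_reversal[OF a set_mono_sublist[OF 2(1)]] by auto
  next
    case 3
    have "mirror a d = d" if "sublist d b" for d
      using mirror_disjoint[of a d] 3(1) set_mono_sublist[OF that] by blast
    moreover have "list_reversal a x = x" if "x \<in> set b" for x
      using that 3(1) by (intro list_reversal_notin) blast
    ultimately show ?thesis by auto
  qed
  \<comment> \<open>The last two conjuncts map the blocks of \<open>b\<close> into those of
    \<open>mirror a b\<close> and back; since \<open>mirror a\<close> is an involution, the first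
    map is onto.\<close>
  moreover from this have "mirror a ` {d. sublist d b} = {d. sublist d (mirror a b)}"
    using mirror_mirror[OF a] by (auto simp: image_iff) metis
  ultimately show ?thesis by (simp add: label_def)
qed

lemma label_mirror_self: "distinct a \<Longrightarrow> label_mirror a (label a) = label a"
  by (simp add: label_mirror_label label_comm_label mirror_self)

lemma label_mirror_conj:
  assumes "distinct c" "sublist b c"
  shows "label_mirror (mirror c b) (label_mirror c x) = label_mirror c (label_mirror b x)"
  using assms sublist_distinct[OF assms(2,1)]
  by (cases x) (simp add: mirror_conj list_reversal_conj image_image)

lemma label_mirror_disjoint:
  assumes "distinct a" "distinct b" "set a \<inter> set b = {}"
  shows "label_mirror a (label_mirror b x) = label_mirror b (label_mirror a x)"
  using assms
  by (cases x) (simp add: mirror_commute_disjoint[of a b] list_reversal_disjoint[of a b] image_image)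

section \<open>The action of tuples and permutations on integer vectors\<close>

text \<open>An element of the semidirect product: the Coxeter generator of \<open>label a\<close>
  times the graph automorphism \<open>label_mirror a\<close>. The automorphism fixes
  \<open>label a\<close>, so the two factors commute and the product is an involution.\<close>

definition reflect :: "nat list \<Rightarrow> (label \<Rightarrow> int) \<Rightarrow> label \<Rightarrow> int" where
  "reflect a v = fire (label a) (v \<circ> label_mirror a)"

lemma fire_comp_label_mirror:
  assumes "distinct a"
  shows "fire x v \<circ> label_mirror a = fire (label_mirror a x) (v \<circ> label_mirror a)"
proof -
  have "inj (label_mirror a)" using label_mirror_invol[OF assms] by (rule inj_on_inverseI)
  from fire_comp[OF this label_comm_mirror[OF assms], of "label_mirror a x" v]
  show ?thesis by (simp add: label_mirror_invol assms)
qed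

text \<open>Collecting the two graph automorphisms on the right splits each relation into one
  between Coxeter generators and one between maps of labels.\<close>

lemma reflect_reflect:
  assumes "distinct a" "distinct b"
  shows "reflect a (reflect b v) =
    fire (label a) (fire (label_mirror a (label b)) (v \<circ> label_mirror b \<circ> label_mirror a))"
  by (simp add: reflect_def fire_comp_label_mirror[OF assms(1)])

lemma reflect_invol: "distinct a \<Longrightarrow> reflect a (reflect a v) = v"
  by (simp add: reflect_reflect label_mirror_self fire_fire comp_def label_mirror_invol)

text \<open>Both sides have the same two Coxeter generators, those of \<open>label c\<close> and
  \<open>label (mirror c b)\<close>, in opposite order, and these commute. The remaining label maps
  agree by conjugation.\<close>

lemma reflect_sublist:
  assumes c: "distinct c" and b: "sublist b c"
  shows "reflect c (reflect b v) = reflect (mirror c b) (reflect c v)"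
proof -
  have db: "distinct b" using sublist_distinct[OF b c] .
  have b': "sublist (mirror c b) c" using b sublist_mirror_iff[OF c] by blast
  have db': "distinct (mirror c b)" using sublist_distinct[OF b' c] .
  have eq: "mirror (mirror c b) c = c"
    using b' sublist_antisym mirror_self[OF c] by (metis mirror_def)
  have "label_mirror (mirror c b) (label c) = label c"
    using label_mirror_label[OF db' c] b' by (simp add: label_comm_label eq)
  moreover have "label_mirror c (label b) = label (mirror c b)"
    using label_mirror_label[OF c db] b by (simp add: label_comm_label)
  \<comment> \<open>Pullbacks compose in reverse order, so the conjugation formula is applied to the
    block \<open>mirror c b\<close>, whose mirror image is \<open>b\<close> again.\<close>
  moreover have "label_mirror b \<circ> label_mirror c = label_mirror c \<circ> label_mirror (mirror c b)"
    using label_mirror_conj[OF c b'] by (simp add: mirror_mirror[OF c] fun_eq_iff)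
  moreover have "label_comm (label c) (label (mirror c b))"
    using b' by (simp add: label_comm_label)
  ultimately show ?thesis
    using fire_commute[of "label c" "label (mirror c b)"]
    by (simp only: reflect_reflect[OF c db] reflect_reflect[OF db' c] comp_assoc)
qed

lemma reflect_disjoint:
  assumes "distinct a" "distinct b" "set a \<inter> set b = {}"
  shows "reflect a (reflect b v) = reflect b (reflect a v)"
proof -
  have "label_mirror b (label a) = label a" "label_mirror a (label b) = label b"
    using assms by (simp_all add: label_mirror_label label_comm_label mirror_disjoint Int_commute)
  moreover have "label_mirror b \<circ> label_mirror a = label_mirror a \<circ> label_mirror b"
    using label_mirror_disjoint[OF assms] by (simp add: fun_eq_iff)
  moreover have "label_comm (label a) (label b)"
    using assms by (simp add: label_comm_label)
  ultimately show ?thesis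
    using fire_commute[of "label a" "label b"]
    by (simp only: reflect_reflect[OF assms(1,2)] reflect_reflect[OF assms(2,1)] comp_assoc)
qed

text \<open>The inverse turns the pullback into a left action, in agreement with composition in
  \<open>sym_group n\<close>.\<close>

definition permute_labels :: "(nat \<Rightarrow> nat) \<Rightarrow> (label \<Rightarrow> int) \<Rightarrow> label \<Rightarrow> int" where
  "permute_labels w v = v \<circ> label_map (inv_into UNIV w)"

lemma permute_labels_comp:
  assumes "bij u" "bij w"
  shows "permute_labels (u \<circ> w) v = permute_labels u (permute_labels w v)"
  using assms by (simp add: permute_labels_def o_inv_distrib fun_eq_iff label_map_comp)

lemma permute_labels_id [simp]: "permute_labels id v = v"
  by (simp add: permute_labels_def)

lemma permute_labels_reflect:
  assumes w: "bij w" and a: "distinct a"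
  shows "permute_labels w (reflect a v) = reflect (map w a) (permute_labels w v)"
proof -
  let ?w' = "inv_into UNIV w"
  have w': "bij ?w'" using w by (rule bij_imp_bij_inv)
  have wa: "map ?w' (map w a) = a" using w by (simp add: bij_is_inj)
  have da: "distinct (map w a)" using a w by (metis distinct_map bij_is_inj inj_on_subset subset_UNIV)
  have "inj (label_map ?w')"
    using w label_map_comp[of w ?w']
    by (intro inj_on_inverseI[of _ "label_map w"]) (simp add: surj_iff[THEN iffD1] bij_is_surj)
  from fire_comp[OF this label_comm_map[OF w'], of "label (map w a)" "v \<circ> label_mirror a"]
  have "permute_labels w (reflect a v)
    = fire (label (map w a)) (v \<circ> label_mirror a \<circ> label_map ?w')"
    by (simp add: permute_labels_def reflect_def label_map_label[OF w'] wa del: map_map)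
  also have "label_mirror a \<circ> label_map ?w' = label_map ?w' \<circ> label_mirror (map w a)"
    using label_map_mirror[OF w' da] wa by (simp add: fun_eq_iff del: map_map)
  then have "v \<circ> label_mirror a \<circ> label_map ?w' = v \<circ> label_map ?w' \<circ> label_mirror (map w a)"
    by (simp add: comp_assoc)
  finally show ?thesis by (simp add: reflect_def permute_labels_def comp_def)
qed

subsection \<open>Groups given by presentations\<close>

lemma word_cong_lists:
  "(u, v) \<in> word_cong A R \<Longrightarrow> u \<in> lists A \<and> v \<in> lists A"
  by (induction rule: word_cong.induct) auto

lemma equiv_word_cong: "equiv (lists A) (word_cong A R)"
proof (rule equivI)
  show "word_cong A R \<subseteq> lists A \<times> lists A"
    using word_cong_lists by fastforce
  show "refl_on (lists A) (word_cong A R)"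
    by (rule refl_onI) (rule word_cong.refl)
  show "Relation.sym (word_cong A R)"
    by (rule symI) (rule word_cong.sym)
  show "Relation.trans (word_cong A R)"
    by (rule transI) (rule word_cong.trans)
qed

lemma word_cong_context:
  assumes "(u, v) \<in> word_cong A R" "p \<in> lists A" "q \<in> lists A"
  shows "(p @ u @ q, p @ v @ q) \<in> word_cong A R"
  using assms(1)
proof induction
  case (refl u)
  then show ?case using assms(2,3) by (intro word_cong.refl) auto
next
  case (rewrite l r p' q')
  then have "((p @ p') @ l @ (q' @ q), (p @ p') @ r @ (q' @ q)) \<in> word_cong A R"
    using assms(2,3) by (intro word_cong.rewrite) auto
  then show ?case by simp
next
  case (sym u v)
  then show ?case by (blast intro: word_cong.sym)
next
  case (trans u v w)
  then show ?case by (blast intro: word_cong.trans)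
qed

lemma word_cong_append:
  assumes "(u, u') \<in> word_cong A R" "(v, v') \<in> word_cong A R"
  shows "(u @ v, u' @ v') \<in> word_cong A R"
proof -
  have "([] @ u @ v, [] @ u' @ v) \<in> word_cong A R" "(u' @ v @ [], u' @ v' @ []) \<in> word_cong A R"
    using word_cong_context[OF assms(1), of "[]" v] word_cong_context[OF assms(2), of u' "[]"]
      assms[THEN word_cong_lists] by auto
  then show ?thesis using word_cong.trans by fastforce
qed

lemma word_cong_rule:
  "(l, r) \<in> R \<Longrightarrow> l \<in> lists A \<Longrightarrow> r \<in> lists A \<Longrightarrow> (l, r) \<in> word_cong A R"
  using word_cong.rewrite[of l r R A "[]" "[]"] by simp

lemma word_class_eq_iff:
  "u \<in> lists A \<Longrightarrow> v \<in> lists A \<Longrightarrow> word_class A R u = word_class A R v \<longleftrightarrow> (u, v) \<in> word_cong A R"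
  unfolding word_class_def by (rule eq_equiv_class_iff[OF equiv_word_cong])

lemma carrier_word_quotient: "carrier (word_quotient A R) = word_class A R ` lists A"
  by (auto simp: word_quotient_def word_class_def quotient_def)

lemma one_word_quotient: "\<one>\<^bsub>word_quotient A R\<^esub> = word_class A R []"
  by (simp add: word_quotient_def)

lemma mult_word_quotient:
  assumes "u \<in> lists A" "v \<in> lists A"
  shows "word_class A R u \<otimes>\<^bsub>word_quotient A R\<^esub> word_class A R v = word_class A R (u @ v)"
proof -
  have "word_class A R (u' @ v') = word_class A R (u @ v)"
    if "u' \<in> word_class A R u" "v' \<in> word_class A R v" for u' v'
  proof -
    from that have "(u @ v, u' @ v') \<in> word_cong A R"
      by (auto simp: word_class_def intro: word_cong_append)
    then show ?thesis
      unfolding word_class_def using equiv_class_eq[OF equiv_word_cong] by fastforce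
  qed
  moreover have "u \<in> word_class A R u" "v \<in> word_class A R v"
    using assms by (auto simp: word_class_def word_cong.refl)
  ultimately have "(\<Union>u'\<in>word_class A R u. \<Union>v'\<in>word_class A R v. word_class A R (u' @ v'))
      = word_class A R (u @ v)"
    by blast
  then show ?thesis by (simp add: word_quotient_def)
qed

lemma word_quotient_cases:
  assumes "z \<in> carrier (word_quotient A R)"
  obtains u where "u \<in> lists A" "z = word_class A R u"
  using assms unfolding carrier_word_quotient by blast

lemma word_class_in_carrier: "u \<in> lists A \<Longrightarrow> word_class A R u \<in> carrier (word_quotient A R)"
  unfolding carrier_word_quotient by (rule imageI)

lemma monoid_word_quotient: "monoid (word_quotient A R)"
proof (rule monoidI)
  let ?Q = "word_quotient A R"
  show one: "\<one>\<^bsub>?Q\<^esub> \<in> carrier ?Q"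
    unfolding one_word_quotient by (rule word_class_in_carrier) simp
  show "x \<otimes>\<^bsub>?Q\<^esub> y \<in> carrier ?Q" if "x \<in> carrier ?Q" "y \<in> carrier ?Q" for x y
    using that by (elim word_quotient_cases) (simp add: mult_word_quotient word_class_in_carrier)
  show "x \<otimes>\<^bsub>?Q\<^esub> y \<otimes>\<^bsub>?Q\<^esub> z = x \<otimes>\<^bsub>?Q\<^esub> (y \<otimes>\<^bsub>?Q\<^esub> z)"
    if "x \<in> carrier ?Q" "y \<in> carrier ?Q" "z \<in> carrier ?Q" for x y z
    using that by (elim word_quotient_cases) (simp add: mult_word_quotient)
  show "\<one>\<^bsub>?Q\<^esub> \<otimes>\<^bsub>?Q\<^esub> x = x" "x \<otimes>\<^bsub>?Q\<^esub> \<one>\<^bsub>?Q\<^esub> = x" if "x \<in> carrier ?Q" for x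
    using that by (elim word_quotient_cases, simp add: one_word_quotient mult_word_quotient)+
qed

text \<open>Left inverses of single letters suffice: concatenated in reverse order they give a left
  inverse of a word.\<close>

lemma group_word_quotient:
  assumes inv: "\<And>x. x \<in> A \<Longrightarrow> \<exists>y\<in>lists A. (y @ [x], []) \<in> word_cong A R"
  shows "group (word_quotient A R)"
proof -
  let ?Q = "word_quotient A R"
  interpret monoid ?Q by (rule monoid_word_quotient)
  have left_inv: "\<exists>v\<in>lists A. (v @ u, []) \<in> word_cong A R" if "u \<in> lists A" for u
    using that
  proof induction
    case Nil
    show ?case by (rule bexI[of _ "[]"]) (auto intro: word_cong.refl)
  next
    case (Cons x u)
    then obtain v y where v: "v \<in> lists A" "(v @ u, []) \<in> word_cong A R"
      and y: "y \<in> lists A" "(y @ [x], []) \<in> word_cong A R"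
      using inv by blast
    have "(v @ (y @ [x]) @ u, v @ [] @ u) \<in> word_cong A R"
      by (rule word_cong_context) (use v y Cons.hyps in auto)
    then have "((v @ y) @ x # u, []) \<in> word_cong A R"
      using word_cong.trans[OF _ v(2)] by simp
    then show ?case using v(1) y(1) by (intro bexI[of _ "v @ y"]) auto
  qed
  have "\<exists>y\<in>carrier ?Q. y \<otimes>\<^bsub>?Q\<^esub> x = \<one>\<^bsub>?Q\<^esub>" if "x \<in> carrier ?Q" for x
  proof -
    from that obtain u where u: "u \<in> lists A" "x = word_class A R u" by (rule word_quotient_cases)
    obtain v where v: "v \<in> lists A" "(v @ u, []) \<in> word_cong A R" using left_inv[OF u(1)] by blast
    have "word_class A R v \<otimes>\<^bsub>?Q\<^esub> x = \<one>\<^bsub>?Q\<^esub>"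
      using u v by (simp add: mult_word_quotient one_word_quotient word_class_eq_iff)
    then show ?thesis using word_class_in_carrier[OF v(1)] by blast
  qed
  then show ?thesis
    by (intro groupI) (simp_all add: m_assoc)
qed

lemma word_quotient_induct [consumes 1, case_names one letter]:
  assumes z: "z \<in> carrier (word_quotient A R)"
    and one: "P \<one>\<^bsub>word_quotient A R\<^esub>"
    and letter: "\<And>x y. x \<in> A \<Longrightarrow> y \<in> carrier (word_quotient A R) \<Longrightarrow> P y
      \<Longrightarrow> P (word_class A R [x] \<otimes>\<^bsub>word_quotient A R\<^esub> y)"
  shows "P z"
proof -
  have "P (word_class A R u)" if "u \<in> lists A" for u
    using that
  proof induction
    case Nil
    show ?case using one unfolding one_word_quotient .
  next
    case (Cons x u)
    have "P (word_class A R [x] \<otimes>\<^bsub>word_quotient A R\<^esub> word_class A R u)"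
      by (rule letter[OF Cons.hyps(1) word_class_in_carrier[OF Cons.hyps(2)] Cons.IH])
    then show ?case using Cons.hyps by (simp add: mult_word_quotient)
  qed
  moreover obtain u where "u \<in> lists A" "z = word_class A R u"
    using z by (rule word_quotient_cases)
  ultimately show ?thesis by simp
qed

lemma word_quotient_universal:
  assumes K: "monoid K" and f: "\<And>x. x \<in> A \<Longrightarrow> f x \<in> carrier K"
    and rules: "\<And>l r. (l, r) \<in> R \<Longrightarrow> l \<in> lists A \<Longrightarrow> r \<in> lists A \<Longrightarrow>
      foldr (\<lambda>x. mult K (f x)) l \<one>\<^bsub>K\<^esub> = foldr (\<lambda>x. mult K (f x)) r \<one>\<^bsub>K\<^esub>"
  obtains h where "h \<in> hom (word_quotient A R) K" "\<And>x. x \<in> A \<Longrightarrow> h (word_class A R [x]) = f x"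
proof -
  interpret K: monoid K by (rule K)
  define ev where "ev u = foldr (\<lambda>x. mult K (f x)) u \<one>\<^bsub>K\<^esub>" for u
  have closed: "ev u \<in> carrier K" if "u \<in> lists A" for u
    using that by (induction u) (auto simp: ev_def f)
  have app: "ev (u @ v) = ev u \<otimes>\<^bsub>K\<^esub> ev v" if "u \<in> lists A" "v \<in> lists A" for u v
    using that(1) by (induction u) (use closed that(2) in \<open>auto simp: ev_def f K.m_assoc\<close>)
  have cong: "ev u = ev v" if "(u, v) \<in> word_cong A R" for u v
    using that
  proof induction
    case (rewrite l r p q)
    then show ?case using rules[of l r] by (simp add: app flip: ev_def)
  qed auto
  \<comment> \<open>The chosen representative is immaterial, because \<open>ev\<close> is constant
    on congruence classes.\<close>
  define h where "h U = ev (SOME u. u \<in> U)" for U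
  have h: "h (word_class A R u) = ev u" if "u \<in> lists A" for u
  proof -
    have "u \<in> word_class A R u" using that by (simp add: word_class_def word_cong.refl)
    then have "(SOME v. v \<in> word_class A R u) \<in> word_class A R u" by (rule someI)
    then show ?thesis unfolding h_def using cong by (simp add: word_class_def)
  qed
  show ?thesis
  proof
    show "h \<in> hom (word_quotient A R) K"
    proof (rule homI)
      fix x assume "x \<in> carrier (word_quotient A R)"
      then show "h x \<in> carrier K" by (elim word_quotient_cases) (simp only: h closed)
    next
      fix x y assume "x \<in> carrier (word_quotient A R)" "y \<in> carrier (word_quotient A R)"
      then obtain u v where "u \<in> lists A" "v \<in> lists A" "x = word_class A R u" "y = word_class A R v"
        by (elim word_quotient_cases) blast
      then show "h (x \<otimes>\<^bsub>word_quotient A R\<^esub> y) = h x \<otimes>\<^bsub>K\<^esub> h y"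
        by (simp only: mult_word_quotient h app append_in_lists_conv)
    qed
    show "h (word_class A R [x]) = f x" if "x \<in> A" for x
      using that h[of "[x]"] f by (simp add: ev_def)
  qed
qed

section \<open>Quotients by the normal closure of relators\<close>

lemma normal_normal_closure:
  assumes G: "group G" and S: "S \<subseteq> carrier G"
  shows "normal_closure G S \<lhd> G"
proof -
  interpret group G by (rule G)
  let ?F = "{N. N \<lhd> G \<and> S \<subseteq> N}"
  have top: "carrier G \<in> ?F" using S normal_inv_iff subgroup_self by auto
  have "subgroup (\<Inter>?F) G"
    by (rule subgroups_Inter) (use top in \<open>auto simp: normal_inv_iff\<close>)
  moreover have "x \<otimes>\<^bsub>G\<^esub> h \<otimes>\<^bsub>G\<^esub> inv\<^bsub>G\<^esub> x \<in> \<Inter>?F" if "x \<in> carrier G" "h \<in> \<Inter>?F" for x h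
    using that by (auto simp: normal_inv_iff)
  ultimately show ?thesis unfolding normal_closure_def normal_inv_iff by blast
qed

context
  fixes G :: "('a, 'b) monoid_scheme" and E :: "('a \<times> 'a) set"
  assumes G: "group G" and E: "E \<subseteq> carrier G \<times> carrier G"
begin

interpretation group G by (rule G)

lemma relators_subset: "relators G E \<subseteq> carrier G"
  using E by (auto simp: relators_def)

lemma normal_relators: "normal_closure G (relators G E) \<lhd> G"
  by (rule normal_normal_closure[OF G relators_subset])

lemma group_impose: "group (impose G E)"
  unfolding impose_def by (rule normal.factorgroup_is_group[OF normal_relators])

lemma impose_proj_hom: "impose_proj G E \<in> hom G (impose G E)"
  using normal.r_coset_hom_Mod[OF normal_relators] by (simp add: impose_def impose_proj_def [abs_def])

lemma carrier_impose: "carrier (impose G E) = impose_proj G E ` carrier G"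
  by (simp add: impose_def impose_proj_def carrier_FactGroup)

lemma impose_proj_eq:
  assumes "(u, v) \<in> E"
  shows "impose_proj G E u = impose_proj G E v"
proof -
  let ?N = "normal_closure G (relators G E)"
  have uv: "u \<in> carrier G" "v \<in> carrier G" using assms E by auto
  have "u \<otimes>\<^bsub>G\<^esub> inv\<^bsub>G\<^esub> v \<in> relators G E" using assms by (auto simp: relators_def)
  then have "u \<otimes>\<^bsub>G\<^esub> inv\<^bsub>G\<^esub> v \<in> ?N" by (auto simp: normal_closure_def)
  then have "u \<in> ?N #>\<^bsub>G\<^esub> v"
    unfolding r_coset_def using uv by (auto intro!: bexI[of _ "u \<otimes>\<^bsub>G\<^esub> inv\<^bsub>G\<^esub> v"] simp: m_assoc)
  then show ?thesis
    unfolding impose_proj_def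
    using repr_independence[OF _ uv(2) normal_imp_subgroup[OF normal_relators]] by blast
qed

lemma impose_universal:
  assumes K: "group K" and h: "h \<in> hom G K" and eq: "\<And>u v. (u, v) \<in> E \<Longrightarrow> h u = h v"
  obtains g where "g \<in> hom (impose G E) K" "\<And>x. x \<in> carrier G \<Longrightarrow> g (impose_proj G E x) = h x"
proof -
  interpret h: group_hom G K h using G K h by (simp add: group_hom_def group_hom_axioms_def)
  have "h (u \<otimes>\<^bsub>G\<^esub> inv\<^bsub>G\<^esub> v) = \<one>\<^bsub>K\<^esub>" if "(u, v) \<in> E" for u v
    using that E eq[OF that] by auto
  then have "relators G E \<subseteq> kernel G K h"
    using E by (auto simp: relators_def kernel_def)
  then have "normal_closure G (relators G E) \<subseteq> kernel G K h"
    unfolding normal_closure_def using h.normal_kernel by blast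
  from h.FactGroup_universal_kernel[OF normal_relators this] that show ?thesis
    unfolding impose_def impose_proj_def by blast
qed

end

section \<open>Free groups\<close>

lemma group_free_group: "group (free_group X)"
  unfolding free_group_def
proof (rule group_word_quotient)
  fix z :: "'a \<times> bool"
  assume z: "z \<in> X \<times> UNIV"
  obtain x b where [simp]: "z = (x, b)" by (cases z)
  have "([(x, \<not> b), (x, \<not> \<not> b)], []) \<in> free_group_rules"
    unfolding free_group_rules_def by blast
  then have "([(x, \<not> b)] @ [z], []) \<in> word_cong (X \<times> UNIV) free_group_rules"
    using z by (intro word_cong_rule) auto
  then show "\<exists>y\<in>lists (X \<times> UNIV). (y @ [z], []) \<in> word_cong (X \<times> UNIV) free_group_rules"
    using z by (intro bexI[of _ "[(x, \<not> b)]"]) auto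
qed

lemma free_gen_closed: "x \<in> X \<Longrightarrow> free_gen X x \<in> carrier (free_group X)"
  unfolding free_gen_def free_group_def by (rule word_class_in_carrier) simp

lemma inv_free_gen:
  assumes "x \<in> X"
  shows "inv\<^bsub>free_group X\<^esub> free_gen X x = word_class (X \<times> UNIV) free_group_rules [(x, False)]"
proof (rule group.inv_equality[OF group_free_group])
  have "([(x, False), (x, \<not> False)], []) \<in> free_group_rules"
    unfolding free_group_rules_def by blast
  then have "([(x, False), (x, True)], []) \<in> word_cong (X \<times> UNIV) free_group_rules"
    using assms by (intro word_cong_rule) auto
  then show "word_class (X \<times> UNIV) free_group_rules [(x, False)] \<otimes>\<^bsub>free_group X\<^esub> free_gen X x
    = \<one>\<^bsub>free_group X\<^esub>"
    using assms
    by (simp add: free_gen_def free_group_def mult_word_quotient one_word_quotient word_class_eq_iff)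
  show "word_class (X \<times> UNIV) free_group_rules [(x, False)] \<in> carrier (free_group X)"
    unfolding free_group_def using assms by (intro word_class_in_carrier) simp
qed (rule free_gen_closed[OF assms])

lemma free_group_induct [consumes 1, case_names one gen inv]:
  assumes z: "z \<in> carrier (free_group X)"
    and one: "P \<one>\<^bsub>free_group X\<^esub>"
    and gen: "\<And>x y. x \<in> X \<Longrightarrow> y \<in> carrier (free_group X) \<Longrightarrow> P y
      \<Longrightarrow> P (free_gen X x \<otimes>\<^bsub>free_group X\<^esub> y)"
    and inv: "\<And>x y. x \<in> X \<Longrightarrow> y \<in> carrier (free_group X) \<Longrightarrow> P y
      \<Longrightarrow> P (inv\<^bsub>free_group X\<^esub> free_gen X x \<otimes>\<^bsub>free_group X\<^esub> y)"
  shows "P z"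
  using z unfolding free_group_def
proof (induction rule: word_quotient_induct)
  case one
  show ?case using assms(2) unfolding free_group_def .
next
  case (letter l y)
  obtain x b where l: "l = (x, b)" by (cases l)
  then have x: "x \<in> X" using letter by simp
  have y: "y \<in> carrier (free_group X)" using letter by (simp add: free_group_def)
  show ?case
  proof (cases b)
    case True
    then show ?thesis using gen[OF x y letter(3)] l by (simp add: free_gen_def free_group_def)
  next
    case False
    then show ?thesis using inv[OF x y letter(3)] l unfolding inv_free_gen[OF x]
      by (simp add: free_group_def)
  qed
qed

lemma free_group_universal:
  assumes K: "group K" and f: "\<And>x. x \<in> X \<Longrightarrow> f x \<in> carrier K"
  obtains h where "h \<in> hom (free_group X) K" "\<And>x. x \<in> X \<Longrightarrow> h (free_gen X x) = f x"
proof -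
  interpret K: group K by (rule K)
  define g where "g = (\<lambda>(x, b). if b then f x else inv\<^bsub>K\<^esub> f x)"
  obtain h where h: "h \<in> hom (word_quotient (X \<times> UNIV) free_group_rules) K"
    "\<And>l. l \<in> X \<times> UNIV \<Longrightarrow> h (word_class (X \<times> UNIV) free_group_rules [l]) = g l"
  proof (rule word_quotient_universal[of K "X \<times> UNIV" g free_group_rules])
    show "monoid K" by (rule K.is_monoid)
    show "g l \<in> carrier K" if "l \<in> X \<times> UNIV" for l
      using that f by (auto simp: g_def)
    show "foldr (\<lambda>x. mult K (g x)) l \<one>\<^bsub>K\<^esub> = foldr (\<lambda>x. mult K (g x)) r \<one>\<^bsub>K\<^esub>"
      if "(l, r) \<in> free_group_rules" "l \<in> lists (X \<times> UNIV)" for l r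
      using that f by (auto simp: free_group_rules_def g_def)
  qed blast
  show ?thesis
  proof
    show "h \<in> hom (free_group X) K" using h(1) by (simp add: free_group_def)
    show "h (free_gen X x) = f x" if "x \<in> X" for x
      using h(2)[of "(x, True)"] that by (simp add: free_gen_def g_def)
  qed
qed

section \<open>Free products of two groups\<close>

context
  fixes G :: "('a, 'c) monoid_scheme" and H :: "('b, 'd) monoid_scheme"
  assumes G: "group G" and H: "group H"
begin

interpretation G: group G by (rule G)
interpretation H: group H by (rule H)

private abbreviation (input) "letters \<equiv> carrier G <+> carrier H"
private abbreviation (input) "rules \<equiv> free_product_rules G H"

lemma free_product_rules_inl:
  "x \<in> carrier G \<Longrightarrow> y \<in> carrier G \<Longrightarrow> ([Inl x, Inl y], [Inl (x \<otimes>\<^bsub>G\<^esub> y)]) \<in> word_cong letters rules"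
  by (rule word_cong_rule) (auto simp: free_product_rules_def)

lemma free_product_rules_inr:
  "x \<in> carrier H \<Longrightarrow> y \<in> carrier H \<Longrightarrow> ([Inr x, Inr y], [Inr (x \<otimes>\<^bsub>H\<^esub> y)]) \<in> word_cong letters rules"
  by (rule word_cong_rule) (auto simp: free_product_rules_def)

lemma free_product_rules_one:
  "([Inl \<one>\<^bsub>G\<^esub>], []) \<in> word_cong letters rules" "([Inr \<one>\<^bsub>H\<^esub>], []) \<in> word_cong letters rules"
  by (rule word_cong_rule; auto simp: free_product_rules_def)+

lemma group_free_product: "group (free_product G H)"
  unfolding free_product_def
proof (rule group_word_quotient)
  fix z
  assume z: "z \<in> letters"
  show "\<exists>y\<in>lists letters. (y @ [z], []) \<in> word_cong letters rules"
  proof (cases z)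
    case (Inl x)
    then have x: "x \<in> carrier G" using z by auto
    then have "([Inl (inv\<^bsub>G\<^esub> x)] @ [z], []) \<in> word_cong letters rules"
      using word_cong.trans[OF free_product_rules_inl[of "inv\<^bsub>G\<^esub> x" x]] Inl free_product_rules_one(1)
      by simp
    then show ?thesis using x by (intro bexI[of _ "[Inl (inv\<^bsub>G\<^esub> x)]"]) auto
  next
    case (Inr x)
    then have x: "x \<in> carrier H" using z by auto
    then have "([Inr (inv\<^bsub>H\<^esub> x)] @ [z], []) \<in> word_cong letters rules"
      using word_cong.trans[OF free_product_rules_inr[of "inv\<^bsub>H\<^esub> x" x]] Inr free_product_rules_one(2)
      by simp
    then show ?thesis using x by (intro bexI[of _ "[Inr (inv\<^bsub>H\<^esub> x)]"]) auto
  qed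
qed

lemma free_product_inl_hom: "free_product_inl G H \<in> hom G (free_product G H)"
proof (rule homI)
  show "free_product_inl G H x \<in> carrier (free_product G H)" if "x \<in> carrier G" for x
    unfolding free_product_inl_def free_product_def using that by (intro word_class_in_carrier) auto
  show "free_product_inl G H (x \<otimes>\<^bsub>G\<^esub> y)
      = free_product_inl G H x \<otimes>\<^bsub>free_product G H\<^esub> free_product_inl G H y"
    if "x \<in> carrier G" "y \<in> carrier G" for x y
    using that free_product_rules_inl[of x y] word_cong.sym
    by (simp add: free_product_inl_def free_product_def mult_word_quotient InlI word_class_eq_iff)
qed

lemma free_product_inr_hom: "free_product_inr G H \<in> hom H (free_product G H)"
proof (rule homI)
  show "free_product_inr G H x \<in> carrier (free_product G H)" if "x \<in> carrier H" for x
    unfolding free_product_inr_def free_product_def using that by (intro word_class_in_carrier) auto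
  show "free_product_inr G H (x \<otimes>\<^bsub>H\<^esub> y)
      = free_product_inr G H x \<otimes>\<^bsub>free_product G H\<^esub> free_product_inr G H y"
    if "x \<in> carrier H" "y \<in> carrier H" for x y
    using that free_product_rules_inr[of x y] word_cong.sym
    by (simp add: free_product_inr_def free_product_def mult_word_quotient InrI word_class_eq_iff)
qed

lemma free_product_induct [consumes 1, case_names one inl inr]:
  assumes z: "z \<in> carrier (free_product G H)"
    and one: "P \<one>\<^bsub>free_product G H\<^esub>"
    and inl: "\<And>x y. x \<in> carrier G \<Longrightarrow> y \<in> carrier (free_product G H) \<Longrightarrow> P y
      \<Longrightarrow> P (free_product_inl G H x \<otimes>\<^bsub>free_product G H\<^esub> y)"
    and inr: "\<And>x y. x \<in> carrier H \<Longrightarrow> y \<in> carrier (free_product G H) \<Longrightarrow> P y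
      \<Longrightarrow> P (free_product_inr G H x \<otimes>\<^bsub>free_product G H\<^esub> y)"
  shows "P z"
  using z unfolding free_product_def
proof (induction rule: word_quotient_induct)
  case one
  show ?case using assms(2) unfolding free_product_def .
next
  case (letter l y)
  have y: "y \<in> carrier (free_product G H)" using letter by (simp add: free_product_def)
  show ?case
  proof (cases l)
    case (Inl x)
    then have x: "x \<in> carrier G" using letter(1) by auto
    show ?thesis
      using inl[OF x y letter(3)] Inl by (simp add: free_product_inl_def free_product_def)
  next
    case (Inr x)
    then have x: "x \<in> carrier H" using letter(1) by auto
    show ?thesis
      using inr[OF x y letter(3)] Inr by (simp add: free_product_inr_def free_product_def)
  qed
qed

lemma free_product_universal:
  assumes K: "group K" and f: "f \<in> hom G K" and g: "g \<in> hom H K"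
  obtains h where "h \<in> hom (free_product G H) K"
    "\<And>x. x \<in> carrier G \<Longrightarrow> h (free_product_inl G H x) = f x"
    "\<And>x. x \<in> carrier H \<Longrightarrow> h (free_product_inr G H x) = g x"
proof -
  interpret K: group K by (rule K)
  interpret f: group_hom G K f using f by unfold_locales
  interpret g: group_hom H K g using g by unfold_locales
  obtain h where h: "h \<in> hom (word_quotient letters rules) K"
    "\<And>l. l \<in> letters \<Longrightarrow> h (word_class letters rules [l]) = case_sum f g l"
  proof (rule word_quotient_universal[of K letters "case_sum f g" rules])
    show "monoid K" by (rule K.is_monoid)
    show "case_sum f g l \<in> carrier K" if "l \<in> letters" for l
      using that by auto
    show "foldr (\<lambda>x. mult K (case_sum f g x)) l \<one>\<^bsub>K\<^esub> = foldr (\<lambda>x. mult K (case_sum f g x)) r \<one>\<^bsub>K\<^esub>"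
      if "(l, r) \<in> rules" "l \<in> lists letters" for l r
      using that by (auto simp: free_product_rules_def)
  qed blast
  show ?thesis
  proof
    show "h \<in> hom (free_product G H) K" using h(1) by (simp add: free_product_def)
    show "h (free_product_inl G H x) = f x" if "x \<in> carrier G" for x
      using h(2)[of "Inl x"] that by (simp add: free_product_inl_def InlI)
    show "h (free_product_inr G H x) = g x" if "x \<in> carrier H" for x
      using h(2)[of "Inr x"] that by (simp add: free_product_inr_def InrI)
  qed
qed

end

subsection \<open>Relations of the virtual cactus group\<close>

lemma cactus_letter_closed:
  "(i, j) \<in> cactus_index n \<Longrightarrow> cactus_letter n i j \<in> carrier (cactus_free n)"
  by (rule free_gen_closed)

lemma interval_reversal_index:
  assumes "(i, j) \<in> cactus_index n" "(k, l) \<in> cactus_index n" "{k..l} \<subseteq> {i..j}"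
  shows "(interval_reversal i j l, interval_reversal i j k) \<in> cactus_index n"
  using assms by (auto simp: cactus_index_def interval_reversal_def)

lemma cactus_relations_closed:
  "cactus_relations n \<subseteq> carrier (cactus_free n) \<times> carrier (cactus_free n)"
proof -
  interpret group "cactus_free n" by (rule group_free_group)
  show ?thesis
    unfolding cactus_relations_def
    by (auto intro!: m_closed one_closed cactus_letter_closed interval_reversal_index)
qed

lemma group_cactus_group: "group (cactus_group n)"
  unfolding cactus_group_def by (rule group_impose[OF group_free_group cactus_relations_closed])

abbreviation "cactus_proj n \<equiv> impose_proj (cactus_free n) (cactus_relations n)"

lemma cactus_proj_group_hom: "group_hom (cactus_free n) (cactus_group n) (cactus_proj n)"
  using group_cactus_group impose_proj_hom[OF group_free_group cactus_relations_closed]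
  by (simp add: group_hom_def group_hom_axioms_def group_free_group cactus_group_def)

lemma cactus_gen_closed: "(i, j) \<in> cactus_index n \<Longrightarrow> cactus_gen n i j \<in> carrier (cactus_group n)"
  unfolding cactus_gen_def
  by (rule group_hom.hom_closed[OF cactus_proj_group_hom cactus_letter_closed])

lemma cactus_gen_relations:
  assumes ij: "(i, j) \<in> cactus_index n"
  shows "cactus_gen n i j \<otimes>\<^bsub>cactus_group n\<^esub> cactus_gen n i j = \<one>\<^bsub>cactus_group n\<^esub>" (is ?square)
    and "(k, l) \<in> cactus_index n \<Longrightarrow> {i..j} \<inter> {k..l} = {} \<Longrightarrow>
      cactus_gen n i j \<otimes>\<^bsub>cactus_group n\<^esub> cactus_gen n k l
      = cactus_gen n k l \<otimes>\<^bsub>cactus_group n\<^esub> cactus_gen n i j" (is "_ \<Longrightarrow> _ \<Longrightarrow> ?disjoint")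
    and "(k, l) \<in> cactus_index n \<Longrightarrow> {k..l} \<subseteq> {i..j} \<Longrightarrow>
      cactus_gen n i j \<otimes>\<^bsub>cactus_group n\<^esub> cactus_gen n k l
      = cactus_gen n (interval_reversal i j l) (interval_reversal i j k)
        \<otimes>\<^bsub>cactus_group n\<^esub> cactus_gen n i j" (is "_ \<Longrightarrow> _ \<Longrightarrow> ?nested")
proof -
  interpret group_hom "cactus_free n" "cactus_group n" "cactus_proj n"
    by (rule cactus_proj_group_hom)
  note eq = impose_proj_eq[OF group_free_group cactus_relations_closed]
  have "(cactus_letter n i j \<otimes>\<^bsub>cactus_free n\<^esub> cactus_letter n i j, \<one>\<^bsub>cactus_free n\<^esub>)
      \<in> cactus_relations n"
    unfolding cactus_relations_def
    by (rule UnI1, rule UnI1, rule CollectI) (rule exI[of _ i], rule exI[of _ j], simp add: ij)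
  from eq[OF this] show ?square
    using ij by (simp add: cactus_letter_closed flip: cactus_gen_def)
  show ?disjoint if kl: "(k, l) \<in> cactus_index n" "{i..j} \<inter> {k..l} = {}"
  proof -
    have "(cactus_letter n i j \<otimes>\<^bsub>cactus_free n\<^esub> cactus_letter n k l,
        cactus_letter n k l \<otimes>\<^bsub>cactus_free n\<^esub> cactus_letter n i j) \<in> cactus_relations n"
      unfolding cactus_relations_def
      by (rule UnI1, rule UnI2, rule CollectI) (rule exI[of _ i], rule exI[of _ j], rule exI[of _ k], rule exI[of _ l], use ij kl in simp)
    from eq[OF this] show ?thesis
      using ij kl by (simp add: cactus_letter_closed flip: cactus_gen_def)
  qed
  show ?nested if kl: "(k, l) \<in> cactus_index n" "{k..l} \<subseteq> {i..j}"
  proof -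
    have "(cactus_letter n i j \<otimes>\<^bsub>cactus_free n\<^esub> cactus_letter n k l,
        cactus_letter n (interval_reversal i j l) (interval_reversal i j k)
          \<otimes>\<^bsub>cactus_free n\<^esub> cactus_letter n i j) \<in> cactus_relations n"
      unfolding cactus_relations_def
      by (rule UnI2, rule CollectI) (rule exI[of _ i], rule exI[of _ j], rule exI[of _ k], rule exI[of _ l], use ij kl in simp)
    from eq[OF this] show ?thesis
      using ij kl interval_reversal_index[OF ij kl]
      by (simp add: cactus_letter_closed flip: cactus_gen_def)
  qed
qed

text \<open>There is no case for inverse letters because each generator is its own inverse.\<close>

lemma cactus_group_induct [consumes 1, case_names one gen]:
  assumes z: "z \<in> carrier (cactus_group n)"
    and one: "P \<one>\<^bsub>cactus_group n\<^esub>"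
    and gen: "\<And>i j y. (i, j) \<in> cactus_index n \<Longrightarrow> y \<in> carrier (cactus_group n) \<Longrightarrow> P y
      \<Longrightarrow> P (cactus_gen n i j \<otimes>\<^bsub>cactus_group n\<^esub> y)"
  shows "P z"
proof -
  interpret group_hom "cactus_free n" "cactus_group n" "cactus_proj n"
    by (rule cactus_proj_group_hom)
  have "P (cactus_proj n x)" if "x \<in> carrier (cactus_free n)" for x
    using that
  proof (induction rule: free_group_induct)
    case one
    show ?case using assms(2) by simp
  next
    case (gen x y)
    obtain i j where x: "x = (i, j)" by (cases x)
    with gen have ij: "(i, j) \<in> cactus_index n" by simp
    from assms(3)[OF ij hom_closed[OF gen(2)] gen(3)] show ?case
      using gen(2) ij by (simp add: x cactus_gen_def cactus_letter_closed)
  next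
    case (inv x y)
    obtain i j where x: "x = (i, j)" by (cases x)
    with inv have ij: "(i, j) \<in> cactus_index n" by simp
    have "inv\<^bsub>cactus_group n\<^esub> cactus_gen n i j = cactus_gen n i j"
      by (rule H.inv_equality[OF cactus_gen_relations(1)[OF ij] cactus_gen_closed[OF ij] cactus_gen_closed[OF ij]])
    with assms(3)[OF ij hom_closed[OF inv(2)] inv(3)] show ?case
      using inv(2) ij by (simp add: x cactus_gen_def cactus_letter_closed)
  qed
  moreover obtain x where "x \<in> carrier (cactus_free n)" "z = cactus_proj n x"
    using z carrier_impose[OF group_free_group cactus_relations_closed, of n]
    by (auto simp: cactus_group_def)
  ultimately show ?thesis by simp
qed

lemma cactus_group_universal:
  assumes K: "group K" and f: "\<And>i j. (i, j) \<in> cactus_index n \<Longrightarrow> f i j \<in> carrier K"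
    and square: "\<And>i j. (i, j) \<in> cactus_index n \<Longrightarrow> f i j \<otimes>\<^bsub>K\<^esub> f i j = \<one>\<^bsub>K\<^esub>"
    and disjoint: "\<And>i j k l. (i, j) \<in> cactus_index n \<Longrightarrow> (k, l) \<in> cactus_index n \<Longrightarrow>
      {i..j} \<inter> {k..l} = {} \<Longrightarrow> f i j \<otimes>\<^bsub>K\<^esub> f k l = f k l \<otimes>\<^bsub>K\<^esub> f i j"
    and nested: "\<And>i j k l. (i, j) \<in> cactus_index n \<Longrightarrow> (k, l) \<in> cactus_index n \<Longrightarrow>
      {k..l} \<subseteq> {i..j} \<Longrightarrow>
      f i j \<otimes>\<^bsub>K\<^esub> f k l = f (interval_reversal i j l) (interval_reversal i j k) \<otimes>\<^bsub>K\<^esub> f i j"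
  obtains h where "h \<in> hom (cactus_group n) K"
    "\<And>i j. (i, j) \<in> cactus_index n \<Longrightarrow> h (cactus_gen n i j) = f i j"
proof -
  have "(case x of (i, j) \<Rightarrow> f i j) \<in> carrier K" if "x \<in> cactus_index n" for x
    using that f by (cases x) simp
  then obtain h where h: "h \<in> hom (cactus_free n) K"
    and gen: "\<And>x. x \<in> cactus_index n \<Longrightarrow> h (free_gen (cactus_index n) x) = (case x of (i, j) \<Rightarrow> f i j)"
    using free_group_universal[OF K, of "cactus_index n" "\<lambda>(i, j). f i j"] by blast
  interpret group_hom "cactus_free n" K h
    using h K by (simp add: group_hom_def group_hom_axioms_def group_free_group)
  have letter: "h (cactus_letter n i j) = f i j" if "(i, j) \<in> cactus_index n" for i j
    using gen[OF that] by simp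
  have "h u = h v" if "(u, v) \<in> cactus_relations n" for u v
    using that unfolding cactus_relations_def
    by (auto simp: letter cactus_letter_closed interval_reversal_index square disjoint nested)
  from impose_universal[OF group_free_group cactus_relations_closed K h this]
  obtain g where "g \<in> hom (cactus_group n) K"
    "\<And>x. x \<in> carrier (cactus_free n) \<Longrightarrow> g (cactus_proj n x) = h x"
    unfolding cactus_group_def by blast
  with that[of g] show ?thesis
    by (simp add: cactus_gen_def letter cactus_letter_closed)
qed

lemma group_cactus_perm: "group (cactus_perm n)"
  unfolding cactus_perm_def by (rule group_free_product[OF group_cactus_group sym_group_is_group])

lemma cactus_perm_perm_hom: "cactus_perm_perm n \<in> hom (sym_group n) (cactus_perm n)"
  unfolding cactus_perm_def cactus_perm_perm_def[abs_def]
  using free_product_inr_hom[OF group_cactus_group sym_group_is_group] by simp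

lemma cactus_perm_perm_closed:
  "w \<in> carrier (sym_group n) \<Longrightarrow> cactus_perm_perm n w \<in> carrier (cactus_perm n)"
  using cactus_perm_perm_hom by (rule hom_in_carrier)

lemma cactus_perm_inl_hom:
  "free_product_inl (cactus_group n) (sym_group n) \<in> hom (cactus_group n) (cactus_perm n)"
  unfolding cactus_perm_def by (rule free_product_inl_hom[OF group_cactus_group sym_group_is_group])

lemma cactus_perm_gen_closed:
  "(i, j) \<in> cactus_index n \<Longrightarrow> cactus_perm_gen n i j \<in> carrier (cactus_perm n)"
  unfolding cactus_perm_gen_def by (rule hom_in_carrier[OF cactus_perm_inl_hom cactus_gen_closed])

lemma shift_index:
  assumes "(i, j) \<in> cactus_index n" "w \<in> carrier (sym_group n)"
    "\<forall>k\<in>{0..j - i}. w (i + k) = w i + k"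
  shows "(w i, w j) \<in> cactus_index n"
proof -
  have ij: "1 \<le> i" "i < j" "j \<le> n" using assms(1) by (auto simp: cactus_index_def)
  have "w (i + (j - i)) = w i + (j - i)" using assms(3) by simp
  moreover have "w i \<in> {1..n}" "w j \<in> {1..n}"
    using ij assms(2) permutes_in_image[of w "{1..n}"] by (simp_all add: sym_group_carrier)
  ultimately show ?thesis using ij by (auto simp: cactus_index_def)
qed

lemma virtual_cactus_relations_closed:
  "virtual_cactus_relations n \<subseteq> carrier (cactus_perm n) \<times> carrier (cactus_perm n)"
proof -
  interpret group "cactus_perm n" by (rule group_cactus_perm)
  show ?thesis
  proof
    fix x assume "x \<in> virtual_cactus_relations n"
    then obtain w i j where "(i, j) \<in> cactus_index n" "w \<in> carrier (sym_group n)"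
      "\<forall>k\<in>{0..j - i}. w (i + k) = w i + k"
      "x = (cactus_perm_perm n w \<otimes>\<^bsub>cactus_perm n\<^esub> cactus_perm_gen n i j
        \<otimes>\<^bsub>cactus_perm n\<^esub> inv\<^bsub>cactus_perm n\<^esub> (cactus_perm_perm n w),
       cactus_perm_gen n (w i) (w j))"
      unfolding virtual_cactus_relations_def by auto
    then show "x \<in> carrier (cactus_perm n) \<times> carrier (cactus_perm n)"
      using shift_index[of i j n w] by (simp add: cactus_perm_gen_closed cactus_perm_perm_closed)
  qed
qed

lemma group_virtual_cactus_group: "group (virtual_cactus_group n)"
  unfolding virtual_cactus_group_def
  by (rule group_impose[OF group_cactus_perm virtual_cactus_relations_closed])

abbreviation "virtual_proj n \<equiv> impose_proj (cactus_perm n) (virtual_cactus_relations n)"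

definition virtual_gen :: "nat \<Rightarrow> nat \<Rightarrow> nat \<Rightarrow> cactus_perm_word set" where
  "virtual_gen n i j = virtual_proj n (cactus_perm_gen n i j)"

definition virtual_perm :: "nat \<Rightarrow> (nat \<Rightarrow> nat) \<Rightarrow> cactus_perm_word set" where
  "virtual_perm n w = virtual_proj n (cactus_perm_perm n w)"

lemma virtual_proj_hom: "virtual_proj n \<in> hom (cactus_perm n) (virtual_cactus_group n)"
  unfolding virtual_cactus_group_def
  by (rule impose_proj_hom[OF group_cactus_perm virtual_cactus_relations_closed])

lemma virtual_proj_group_hom: "group_hom (cactus_perm n) (virtual_cactus_group n) (virtual_proj n)"
  by (simp add: group_hom_def group_hom_axioms_def group_cactus_perm group_virtual_cactus_group
      virtual_proj_hom)

lemma virtual_perm_hom: "virtual_perm n \<in> hom (sym_group n) (virtual_cactus_group n)"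
  using hom_compose[OF cactus_perm_perm_hom virtual_proj_hom]
  by (simp add: virtual_perm_def[abs_def] comp_def)

lemma virtual_inl_hom:
  "virtual_proj n \<circ> free_product_inl (cactus_group n) (sym_group n)
    \<in> hom (cactus_group n) (virtual_cactus_group n)"
  by (rule hom_compose[OF cactus_perm_inl_hom virtual_proj_hom])

lemma virtual_gen_eq:
  "virtual_gen n i j
    = (virtual_proj n \<circ> free_product_inl (cactus_group n) (sym_group n)) (cactus_gen n i j)"
  by (simp add: virtual_gen_def cactus_perm_gen_def)

lemma virtual_gen_closed:
  "(i, j) \<in> cactus_index n \<Longrightarrow> virtual_gen n i j \<in> carrier (virtual_cactus_group n)"
  unfolding virtual_gen_eq by (rule hom_in_carrier[OF virtual_inl_hom cactus_gen_closed])

lemma virtual_gen_relations: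
  assumes ij: "(i, j) \<in> cactus_index n"
  shows "virtual_gen n i j \<otimes>\<^bsub>virtual_cactus_group n\<^esub> virtual_gen n i j = \<one>\<^bsub>virtual_cactus_group n\<^esub>"
    (is ?square)
    and "(k, l) \<in> cactus_index n \<Longrightarrow> {i..j} \<inter> {k..l} = {} \<Longrightarrow>
      virtual_gen n i j \<otimes>\<^bsub>virtual_cactus_group n\<^esub> virtual_gen n k l
      = virtual_gen n k l \<otimes>\<^bsub>virtual_cactus_group n\<^esub> virtual_gen n i j" (is "_ \<Longrightarrow> _ \<Longrightarrow> ?disjoint")
    and "(k, l) \<in> cactus_index n \<Longrightarrow> {k..l} \<subseteq> {i..j} \<Longrightarrow>
      virtual_gen n i j \<otimes>\<^bsub>virtual_cactus_group n\<^esub> virtual_gen n k l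
      = virtual_gen n (interval_reversal i j l) (interval_reversal i j k)
        \<otimes>\<^bsub>virtual_cactus_group n\<^esub> virtual_gen n i j" (is "_ \<Longrightarrow> _ \<Longrightarrow> ?nested")
    and "w \<in> carrier (sym_group n) \<Longrightarrow> \<forall>k\<in>{0..j - i}. w (i + k) = w i + k \<Longrightarrow>
      virtual_perm n w \<otimes>\<^bsub>virtual_cactus_group n\<^esub> virtual_gen n i j
        \<otimes>\<^bsub>virtual_cactus_group n\<^esub> inv\<^bsub>virtual_cactus_group n\<^esub> virtual_perm n w
      = virtual_gen n (w i) (w j)" (is "_ \<Longrightarrow> _ \<Longrightarrow> ?conj")
proof -
  let ?\<iota> = "virtual_proj n \<circ> free_product_inl (cactus_group n) (sym_group n)"
  interpret \<iota>: group_hom "cactus_group n" "virtual_cactus_group n" ?\<iota>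
    using virtual_inl_hom
    by (simp add: group_hom_def group_hom_axioms_def group_cactus_group group_virtual_cactus_group)
  interpret proj: group_hom "cactus_perm n" "virtual_cactus_group n" "virtual_proj n"
    by (rule virtual_proj_group_hom)
  note mult = \<iota>.hom_mult[symmetric, OF cactus_gen_closed cactus_gen_closed]
  show ?square
    using ij cactus_gen_relations(1)[OF ij] unfolding virtual_gen_eq by (simp only: mult \<iota>.hom_one)
  show ?disjoint if "(k, l) \<in> cactus_index n" "{i..j} \<inter> {k..l} = {}"
    using ij that(1) cactus_gen_relations(2)[OF ij that] unfolding virtual_gen_eq by (simp only: mult)
  show ?nested if "(k, l) \<in> cactus_index n" "{k..l} \<subseteq> {i..j}"
    using ij that(1) interval_reversal_index[OF ij that] cactus_gen_relations(3)[OF ij that]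
    unfolding virtual_gen_eq by (simp only: mult)
  show ?conj if w: "w \<in> carrier (sym_group n)" "\<forall>k\<in>{0..j - i}. w (i + k) = w i + k"
  proof -
    have "(cactus_perm_perm n w \<otimes>\<^bsub>cactus_perm n\<^esub> cactus_perm_gen n i j
        \<otimes>\<^bsub>cactus_perm n\<^esub> inv\<^bsub>cactus_perm n\<^esub> (cactus_perm_perm n w),
       cactus_perm_gen n (w i) (w j)) \<in> virtual_cactus_relations n"
      unfolding virtual_cactus_relations_def by (rule CollectI) (rule exI[of _ w], rule exI[of _ i], rule exI[of _ j], use ij w in blast)
    from impose_proj_eq[OF group_cactus_perm virtual_cactus_relations_closed this]
    show ?thesis
      using ij w(1) by (simp add: cactus_perm_gen_closed cactus_perm_perm_closed
          flip: virtual_gen_def virtual_perm_def)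
  qed
qed

text \<open>A letter of the free product may be any element of the cactus group. Such letters are
  first broken into generators by \<open>inl_mult\<close>; closure under left multiplication then
  absorbs one letter at a time.\<close>

lemma virtual_cactus_group_generated:
  assumes one: "\<one>\<^bsub>virtual_cactus_group n\<^esub> \<in> X"
    and gen: "\<And>i j x. (i, j) \<in> cactus_index n \<Longrightarrow> x \<in> X \<Longrightarrow>
      virtual_gen n i j \<otimes>\<^bsub>virtual_cactus_group n\<^esub> x \<in> X"
    and perm: "\<And>w x. w \<in> carrier (sym_group n) \<Longrightarrow> x \<in> X \<Longrightarrow>
      virtual_perm n w \<otimes>\<^bsub>virtual_cactus_group n\<^esub> x \<in> X"
    and X: "X \<subseteq> carrier (virtual_cactus_group n)"
  shows "carrier (virtual_cactus_group n) \<subseteq> X"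
proof -
  let ?\<iota> = "virtual_proj n \<circ> free_product_inl (cactus_group n) (sym_group n)"
  interpret \<iota>: group_hom "cactus_group n" "virtual_cactus_group n" ?\<iota>
    using virtual_inl_hom
    by (simp add: group_hom_def group_hom_axioms_def group_cactus_group group_virtual_cactus_group)
  interpret proj: group_hom "cactus_perm n" "virtual_cactus_group n" "virtual_proj n"
    by (rule virtual_proj_group_hom)
  have inl_mult: "?\<iota> c \<otimes>\<^bsub>virtual_cactus_group n\<^esub> x \<in> X"
    if "c \<in> carrier (cactus_group n)" "x \<in> X" for c x
    using that
  proof (induction arbitrary: x rule: cactus_group_induct)
    case one
    then have "x \<in> carrier (virtual_cactus_group n)" using X by blast
    then show ?case using one by (simp only: \<iota>.hom_one \<iota>.H.l_one)
  next
    case (gen i j y)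
    have "x \<in> carrier (virtual_cactus_group n)" using gen X by blast
    then have "?\<iota> (cactus_gen n i j \<otimes>\<^bsub>cactus_group n\<^esub> y) \<otimes>\<^bsub>virtual_cactus_group n\<^esub> x
      = virtual_gen n i j \<otimes>\<^bsub>virtual_cactus_group n\<^esub> (?\<iota> y \<otimes>\<^bsub>virtual_cactus_group n\<^esub> x)"
      unfolding virtual_gen_eq
      by (simp only: \<iota>.hom_mult[OF cactus_gen_closed[OF gen(1)] gen(2)]
          \<iota>.H.m_assoc[OF \<iota>.hom_closed[OF cactus_gen_closed[OF gen(1)]] \<iota>.hom_closed[OF gen(2)]])
    also have "\<dots> \<in> X" by (rule assms(2)[OF gen(1) gen(3)[OF gen(4)]])
    finally show ?case .
  qed
  have "virtual_proj n z \<in> X" if "z \<in> carrier (cactus_perm n)" for z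
    using that unfolding cactus_perm_def
  proof (induction rule: free_product_induct[OF group_cactus_group sym_group_is_group, consumes 1, case_names one inl inr])
    case one
    show ?case using assms(1) by (simp flip: cactus_perm_def)
  next
    case (inl c y)
    then show ?case
      using inl_mult[OF inl(1,3)]
        hom_in_carrier[OF cactus_perm_inl_hom inl(1)]
      by (simp flip: cactus_perm_def)
  next
    case (inr w y)
    then show ?case
      using perm[OF inr(1,3)] cactus_perm_perm_closed[OF inr(1)]
      by (simp add: virtual_perm_def cactus_perm_perm_def flip: cactus_perm_def)
  qed
  then show ?thesis
    unfolding virtual_cactus_group_def
    using carrier_impose[OF group_cactus_perm virtual_cactus_relations_closed] by auto
qed

lemma virtual_cactus_group_universal:
  assumes K: "group K" and f: "\<And>i j. (i, j) \<in> cactus_index n \<Longrightarrow> f i j \<in> carrier K"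
    and square: "\<And>i j. (i, j) \<in> cactus_index n \<Longrightarrow> f i j \<otimes>\<^bsub>K\<^esub> f i j = \<one>\<^bsub>K\<^esub>"
    and disjoint: "\<And>i j k l. (i, j) \<in> cactus_index n \<Longrightarrow> (k, l) \<in> cactus_index n \<Longrightarrow>
      {i..j} \<inter> {k..l} = {} \<Longrightarrow> f i j \<otimes>\<^bsub>K\<^esub> f k l = f k l \<otimes>\<^bsub>K\<^esub> f i j"
    and nested: "\<And>i j k l. (i, j) \<in> cactus_index n \<Longrightarrow> (k, l) \<in> cactus_index n \<Longrightarrow>
      {k..l} \<subseteq> {i..j} \<Longrightarrow>
      f i j \<otimes>\<^bsub>K\<^esub> f k l = f (interval_reversal i j l) (interval_reversal i j k) \<otimes>\<^bsub>K\<^esub> f i j"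
    and g: "g \<in> hom (sym_group n) K"
    and conj: "\<And>w i j. (i, j) \<in> cactus_index n \<Longrightarrow> w \<in> carrier (sym_group n) \<Longrightarrow>
      \<forall>k\<in>{0..j - i}. w (i + k) = w i + k \<Longrightarrow> g w \<otimes>\<^bsub>K\<^esub> f i j = f (w i) (w j) \<otimes>\<^bsub>K\<^esub> g w"
  obtains h where "h \<in> hom (virtual_cactus_group n) K"
    "\<And>i j. (i, j) \<in> cactus_index n \<Longrightarrow> h (virtual_gen n i j) = f i j"
    "\<And>w. w \<in> carrier (sym_group n) \<Longrightarrow> h (virtual_perm n w) = g w"
proof -
  interpret K: group K by (rule K)
  obtain h1 where h1: "h1 \<in> hom (cactus_group n) K"
    "\<And>i j. (i, j) \<in> cactus_index n \<Longrightarrow> h1 (cactus_gen n i j) = f i j"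
    using cactus_group_universal[OF K f square disjoint nested] by blast
  obtain h2 where h2: "h2 \<in> hom (cactus_perm n) K"
    "\<And>x. x \<in> carrier (cactus_group n) \<Longrightarrow> h2 (free_product_inl (cactus_group n) (sym_group n) x) = h1 x"
    "\<And>w. w \<in> carrier (sym_group n) \<Longrightarrow> h2 (cactus_perm_perm n w) = g w"
    unfolding cactus_perm_def cactus_perm_perm_def
    using free_product_universal[OF group_cactus_group sym_group_is_group K h1(1) g] by blast
  interpret h2: group_hom "cactus_perm n" K h2
    using h2(1) K by (simp add: group_hom_def group_hom_axioms_def group_cactus_perm)
  have gen: "h2 (cactus_perm_gen n i j) = f i j" if "(i, j) \<in> cactus_index n" for i j
    using that by (simp add: cactus_perm_gen_def h2(2) h1(2) cactus_gen_closed)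
  have "h2 u = h2 v" if uv: "(u, v) \<in> virtual_cactus_relations n" for u v
  proof -
    obtain w i j where ij: "(i, j) \<in> cactus_index n" and w: "w \<in> carrier (sym_group n)"
      "\<forall>k\<in>{0..j - i}. w (i + k) = w i + k" and v: "v = cactus_perm_gen n (w i) (w j)"
      and u: "u = cactus_perm_perm n w \<otimes>\<^bsub>cactus_perm n\<^esub> cactus_perm_gen n i j
        \<otimes>\<^bsub>cactus_perm n\<^esub> inv\<^bsub>cactus_perm n\<^esub> (cactus_perm_perm n w)"
      using uv unfolding virtual_cactus_relations_def by auto
    have idx: "(w i, w j) \<in> cactus_index n" using shift_index[OF ij w] .
    have gw: "g w \<in> carrier K" using g w(1) by (rule hom_in_carrier)
    have "h2 u = g w \<otimes>\<^bsub>K\<^esub> f i j \<otimes>\<^bsub>K\<^esub> inv\<^bsub>K\<^esub> g w"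
      using ij w(1) by (simp add: u gen h2(3) cactus_perm_perm_closed cactus_perm_gen_closed)
    also have "\<dots> = f (w i) (w j)"
      using gw f[OF idx] by (simp add: conj[OF ij w] K.m_assoc)
    finally show ?thesis using idx by (simp add: v gen)
  qed
  from impose_universal[OF group_cactus_perm virtual_cactus_relations_closed K h2(1) this]
  obtain h where "h \<in> hom (virtual_cactus_group n) K"
    "\<And>x. x \<in> carrier (cactus_perm n) \<Longrightarrow> h (virtual_proj n x) = h2 x"
    unfolding virtual_cactus_group_def by blast
  with that[of h] show ?thesis
    by (simp add: virtual_gen_def virtual_perm_def gen h2(3) cactus_perm_gen_closed cactus_perm_perm_closed)
qed

subsection \<open>Linear actions on finitely many integer coordinates\<close>

text \<open>The maps act on vectors that may have infinitely many coordinates. The condition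
  concerns only the coordinates in \<open>L\<close> and forces them to depend on nothing outside
  \<open>L\<close>, so that the action restricts to a lattice of finite rank when \<open>L\<close>
  is finite.\<close>

definition linear_on :: "'l set \<Rightarrow> (('l \<Rightarrow> int) \<Rightarrow> 'l \<Rightarrow> int) \<Rightarrow> bool" where
  "linear_on L \<phi> \<longleftrightarrow> (\<exists>K. \<forall>v. \<forall>b\<in>L. \<phi> v b = (\<Sum>c\<in>L. K b c * v c))"

lemma linear_on_comp:
  assumes "linear_on L \<phi>" "linear_on L \<psi>"
  shows "linear_on L (\<lambda>v. \<phi> (\<psi> v))"
proof -
  obtain A where A: "\<forall>v. \<forall>b\<in>L. \<phi> v b = (\<Sum>c\<in>L. A b c * v c)"
    using assms(1) unfolding linear_on_def by (rule exE)
  obtain B where B: "\<forall>v. \<forall>b\<in>L. \<psi> v b = (\<Sum>c\<in>L. B b c * v c)"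
    using assms(2) unfolding linear_on_def by (rule exE)
  have "\<phi> (\<psi> v) b = (\<Sum>d\<in>L. (\<Sum>c\<in>L. A b c * B c d) * v d)" if "b \<in> L" for v b
  proof -
    have "\<phi> (\<psi> v) b = (\<Sum>c\<in>L. \<Sum>d\<in>L. A b c * B c d * v d)"
      using A B that by (simp add: sum_distrib_left mult.assoc)
    also have "\<dots> = (\<Sum>d\<in>L. \<Sum>c\<in>L. A b c * B c d * v d)" by (rule sum.swap)
    finally show ?thesis by (simp add: sum_distrib_right)
  qed
  then show ?thesis
    unfolding linear_on_def by (intro exI[of _ "\<lambda>b d. \<Sum>c\<in>L. A b c * B c d"]) blast
qed

lemma linear_on_pullback:
  assumes "finite L" "f ` L \<subseteq> L"
  shows "linear_on L (\<lambda>v. v \<circ> f)"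
  unfolding linear_on_def
proof (intro exI allI ballI)
  fix v :: "'a \<Rightarrow> int" and b
  assume "b \<in> L"
  then have "f b \<in> L" using assms(2) by blast
  then show "(v \<circ> f) b = (\<Sum>c\<in>L. (if c = f b then 1 else 0) * v c)"
    using assms(1) by (simp add: if_distrib[of "\<lambda>x. x * _"] sum.delta cong: if_cong)
qed

text \<open>The coefficients are read off on unit vectors, which later defines the matrix of a map
  without choosing \<open>K\<close>.\<close>

lemma linear_on_expand:
  assumes L: "finite L" and lin: "linear_on L \<phi>" and b: "b \<in> L"
  shows "\<phi> v b = (\<Sum>c\<in>L. \<phi> (\<lambda>x. if x = c then 1 else 0) b * v c)"
proof -
  obtain A where A: "\<forall>v. \<forall>b\<in>L. \<phi> v b = (\<Sum>c\<in>L. A b c * v c)"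
    using lin unfolding linear_on_def by (rule exE)
  have "\<phi> (\<lambda>x. if x = c then 1 else 0) b = A b c" if "c \<in> L" for c
    using L that A b by (simp add: if_distrib[of "\<lambda>x. _ * x"] sum.delta cong: if_cong)
  then show ?thesis using A b by simp
qed

text \<open>The columns of \<open>M x\<close> are the images of the unit vectors, restricted to
  \<open>L\<close>. Invertibility over the integers comes from the matrix of the inverse
  element.\<close>

lemma Z_linearI:
  fixes G :: "('g, 'h) monoid_scheme" and \<rho> :: "'g \<Rightarrow> ('l \<Rightarrow> int) \<Rightarrow> 'l \<Rightarrow> int"
  assumes G: "group G" and L: "finite L" "L \<noteq> {}"
    and mult: "\<And>x y v. x \<in> carrier G \<Longrightarrow> y \<in> carrier G \<Longrightarrow> \<rho> (x \<otimes>\<^bsub>G\<^esub> y) v = \<rho> x (\<rho> y v)"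
    and one: "\<And>v. \<rho> \<one>\<^bsub>G\<^esub> v = v"
    and lin: "\<And>x. x \<in> carrier G \<Longrightarrow> linear_on L (\<rho> x)"
    and faithful: "\<And>x. x \<in> carrier G \<Longrightarrow> (\<And>v b. b \<in> L \<Longrightarrow> \<rho> x v b = v b) \<Longrightarrow> x = \<one>\<^bsub>G\<^esub>"
  shows "Z_linear G"
proof -
  interpret G: group G by (rule G)
  define m where "m = card L"
  obtain e where e: "bij_betw e {0..<m} L"
    using ex_bij_betw_nat_finite[OF L(1)] unfolding m_def by blast
  define M where "M x = mat m m (\<lambda>(i, j). \<rho> x (\<lambda>b. if b = e j then 1 else 0) (e i))" for x
  have expand: "\<rho> x v (e i) = (\<Sum>k\<in>{0..<m}. M x $$ (i, k) * v (e k))"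
    if "x \<in> carrier G" "i < m" for x v i
  proof -
    have "e i \<in> L" using e that(2) by (auto simp: bij_betw_def)
    from linear_on_expand[OF L(1) lin[OF that(1)] this, of v]
    have "\<rho> x v (e i) = (\<Sum>k\<in>{0..<m}. \<rho> x (\<lambda>b. if b = e k then 1 else 0) (e i) * v (e k))"
      unfolding sum.reindex_bij_betw[OF e, symmetric] .
    also have "\<dots> = (\<Sum>k\<in>{0..<m}. M x $$ (i, k) * v (e k))"
      using that(2) by (intro sum.cong HOL.refl) (simp add: M_def)
    finally show ?thesis .
  qed
  have M_carrier: "M x \<in> carrier_mat m m" for x by (simp add: M_def)
  have M_mult: "M (x \<otimes>\<^bsub>G\<^esub> y) = M x * M y" if "x \<in> carrier G" "y \<in> carrier G" for x y
  proof (rule eq_matI)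
    fix i j assume "i < dim_row (M x * M y)" "j < dim_col (M x * M y)"
    then have ij: "i < m" "j < m" by (simp_all add: M_def)
    have "M (x \<otimes>\<^bsub>G\<^esub> y) $$ (i, j) = \<rho> x (\<rho> y (\<lambda>b. if b = e j then 1 else 0)) (e i)"
      using ij that by (simp add: M_def mult)
    also have "\<dots> = (\<Sum>k\<in>{0..<m}. M x $$ (i, k) * M y $$ (k, j))"
      unfolding expand[OF that(1) ij(1)] using ij by (intro sum.cong HOL.refl) (simp add: M_def)
    also have "\<dots> = (M x * M y) $$ (i, j)"
      using ij by (simp add: M_def scalar_prod_def)
    finally show "M (x \<otimes>\<^bsub>G\<^esub> y) $$ (i, j) = (M x * M y) $$ (i, j)" .
  qed (simp_all add: M_def)
  have M_one: "M \<one>\<^bsub>G\<^esub> = 1\<^sub>m m"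
  proof (rule eq_matI)
    fix i j assume "i < dim_row (1\<^sub>m m :: int mat)" "j < dim_col (1\<^sub>m m :: int mat)"
    then have ij: "i < m" "j < m" by simp_all
    then have "e i = e j \<longleftrightarrow> i = j" using e by (auto simp: bij_betw_def dest: inj_onD)
    then show "M \<one>\<^bsub>G\<^esub> $$ (i, j) = 1\<^sub>m m $$ (i, j)" using ij by (simp add: M_def one)
  qed (simp_all add: M_def)
  let ?R = "ring_mat TYPE(int) m ()"
  interpret R: semiring ?R by (rule semiring_mat)
  have M_units: "M x \<in> carrier (GL_int m)" if "x \<in> carrier G" for x
  proof -
    have "M x * M (inv\<^bsub>G\<^esub> x) = 1\<^sub>m m" "M (inv\<^bsub>G\<^esub> x) * M x = 1\<^sub>m m"
      using that M_mult[of x "inv\<^bsub>G\<^esub> x"] M_mult[of "inv\<^bsub>G\<^esub> x" x] M_one by simp_all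
    then show ?thesis
      unfolding GL_int_def units_of_carrier Units_def ring_mat_simps
      using M_carrier by (intro CollectI conjI bexI[of _ "M (inv\<^bsub>G\<^esub> x)"])
  qed
  have hom: "M \<in> hom G (GL_int m)"
    using M_units M_mult by (intro homI) (simp_all add: GL_int_def units_of_mult ring_mat_simps)
  have GL: "group (GL_int m)"
    unfolding GL_int_def by (rule R.units_group)
  interpret group_hom G "GL_int m" M
    using hom GL by (simp add: group_hom_def group_hom_axioms_def G)
  have "x = \<one>\<^bsub>G\<^esub>" if x: "x \<in> carrier G" "M x = \<one>\<^bsub>GL_int m\<^esub>" for x
  proof (rule faithful[OF x(1)])
    fix v b assume "b \<in> L"
    then obtain i where i: "i < m" "b = e i" using e by (auto simp: bij_betw_def)
    have "M x = 1\<^sub>m m" using x(2) by (simp add: GL_int_def units_of_one ring_mat_simps)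
    then have "\<rho> x v b = (\<Sum>k\<in>{0..<m}. (if k = i then v (e k) else 0))"
      unfolding i(2) expand[OF x(1) i(1)] using i(1) by (intro sum.cong HOL.refl) auto
    then show "\<rho> x v b = v b" using i by (simp add: sum.delta)
  qed
  then have inj: "inj_on M (carrier G)"
    by (simp add: inj_on_one_iff)
  have "M \<in> iso G ((GL_int m)\<lparr>carrier := M ` carrier G\<rparr>)"
  proof (rule isoI)
    show "M \<in> hom G ((GL_int m)\<lparr>carrier := M ` carrier G\<rparr>)"
      by (rule homI) simp_all
    show "bij_betw M (carrier G) (carrier ((GL_int m)\<lparr>carrier := M ` carrier G\<rparr>))"
      using inj by (simp add: bij_betw_def)
  qed
  then have "G \<cong> (GL_int m)\<lparr>carrier := M ` carrier G\<rparr>" by (rule is_isoI)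
  moreover have "m \<ge> 1" using L by (simp add: m_def card_gt_0_iff Suc_le_eq)
  ultimately show ?thesis
    unfolding Z_linear_def using G img_is_subgroup by (intro conjI exI[of _ m] exI[of _ "M ` carrier G"])
qed

subsection \<open>Generators indexed by tuples\<close>

lemma ex_permutes_map:
  assumes "length xs = length ys" "distinct xs" "distinct ys" "set xs \<subseteq> A" "set ys \<subseteq> A"
  shows "\<exists>w. w permutes A \<and> map w xs = ys"
  using assms
proof (induction xs ys rule: list_induct2)
  case Nil
  show ?case by (intro exI[of _ id] conjI permutes_id) simp
next
  case (Cons x xs y ys)
  then obtain w where w: "w permutes A" "map w xs = ys" by auto
  have wx: "w x \<in> A" using Cons.prems w(1) by (simp add: permutes_in_image)
  \<comment> \<open>The transposition corrects the image of \<open>x\<close> and leaves the images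
    of \<open>xs\<close> alone: these are the entries of \<open>ys\<close>, which differ from
    \<open>w x\<close> by injectivity and from \<open>y\<close> by distinctness.\<close>
  have "transpose (w x) y (w z) = w z" if "z \<in> set xs" for z
  proof -
    have "w z \<noteq> w x" using that Cons.prems(1) permutes_inj[OF w(1)] by (auto dest: injD)
    moreover have "w z \<noteq> y" using that Cons.prems(2) w(2) by auto
    ultimately show ?thesis by simp
  qed
  then have "map (transpose (w x) y \<circ> w) (x # xs) = y # ys" using w(2) by auto
  moreover have "transpose (w x) y \<circ> w permutes A"
    using permutes_compose[OF w(1) permutes_swap_id[OF wx]] Cons.prems(4) by simp
  ultimately show ?case by (intro exI[of _ "transpose (w x) y \<circ> w"] conjI)
qed

lemma rev_map_interval_reversal:
  assumes "i \<le> k" "k \<le> Suc l" "l \<le> j"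
  shows "rev (map (interval_reversal i j) [k..<Suc l]) = [i + j - l..<Suc (i + j) - k]"
proof (rule nth_equalityI)
  fix t assume "t < length (rev (map (interval_reversal i j) [k..<Suc l]))"
  then have t: "t < Suc l - k" by (simp del: upt_Suc)
  have "rev (map (interval_reversal i j) [k..<Suc l]) ! t = interval_reversal i j (l - t)"
    using t by (simp add: rev_nth del: upt_Suc)
  also have "\<dots> = i + j - (l - t)"
    unfolding interval_reversal_def using t assms by (intro if_P conjI; arith)
  also have "\<dots> = [i + j - l..<Suc (i + j) - k] ! t"
    using t assms by (simp del: upt_Suc)
  finally show "rev (map (interval_reversal i j) [k..<Suc l]) ! t = [i + j - l..<Suc (i + j) - k] ! t" .
qed (use assms in \<open>simp del: upt_Suc\<close>)

lemma list_reversal_interval: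
  assumes "i \<le> j"
  shows "list_reversal [i..<Suc j] = interval_reversal i j"
proof (rule list_reversal_unique[symmetric])
  have "rev (map (interval_reversal i j) [i..<Suc j]) = [i..<Suc j]"
    using rev_map_interval_reversal[of i i j j] assms by (simp del: upt_Suc)
  then show "map (interval_reversal i j) [i..<Suc j] = rev [i..<Suc j]"
    by (metis rev_rev_ident)
  show "interval_reversal i j x = x" if "x \<notin> set [i..<Suc j]" for x
    using that by (auto simp: interval_reversal_def simp del: upt_Suc)
qed (rule distinct_upt)

lemma upt_split: "i \<le> j \<Longrightarrow> j \<le> k \<Longrightarrow> [i..<k] = [i..<j] @ [j..<k]"
  using upt_add_eq_append[of i j "k - j"] by simp

lemma sublist_interval:
  assumes "i \<le> k" "k \<le> Suc l" "l \<le> j"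
  shows "sublist [k..<Suc l] [i..<Suc j]"
proof -
  have "[i..<Suc j] = [i..<k] @ [k..<Suc l] @ [Suc l..<Suc j]"
    using assms upt_split[of i k "Suc j"] upt_split[of k "Suc l" "Suc j"]
    by (simp del: upt_Suc)
  then show ?thesis unfolding sublist_def by (rule exI[of _ "[i..<k]", OF exI])
qed

lemma mirror_interval:
  assumes "i \<le> k" "k \<le> l" "l \<le> j"
  shows "mirror [i..<Suc j] [k..<Suc l] = [interval_reversal i j l..<Suc (interval_reversal i j k)]"
proof -
  have "interval_reversal i j l = i + j - l" "Suc (interval_reversal i j k) = Suc (i + j) - k"
    using assms by (simp_all add: interval_reversal_def)
  moreover have "sublist [k..<Suc l] [i..<Suc j]" using assms by (intro sublist_interval) simp_all
  ultimately show ?thesis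
    using assms rev_map_interval_reversal[of i k l j]
    by (simp add: mirror_def list_reversal_interval del: upt_Suc)
qed

lemma map_shift_interval:
  fixes w :: "nat \<Rightarrow> nat"
  assumes "i \<le> j" "\<forall>k\<in>{0..j - i}. w (i + k) = w i + k"
  shows "map w [i..<Suc j] = [w i..<Suc (w j)]"
proof -
  have "w (i + (j - i)) = w i + (j - i)" using assms(2) by simp
  then have "w j = w i + (j - i)" using assms(1) by simp
  then show ?thesis using assms by (intro nth_equalityI) (simp_all del: upt_Suc)
qed

lemma (in group) conj_mult:
  "x \<in> carrier G \<Longrightarrow> a \<in> carrier G \<Longrightarrow> b \<in> carrier G \<Longrightarrow>
    x \<otimes> a \<otimes> inv x \<otimes> (x \<otimes> b \<otimes> inv x) = x \<otimes> (a \<otimes> b) \<otimes> inv x"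
  by (simp add: m_assoc) (simp add: m_assoc[symmetric])

text \<open>Blocks of a tuple can have length 0 or 1, so labels need these short lists as well;
  \<open>tuples\<close> keeps the lists that index a generator, which has at least two
  entries.\<close>

definition subtuples :: "nat \<Rightarrow> nat list set" where
  "subtuples n = {a. distinct a \<and> set a \<subseteq> {1..n}}"

lemma sublist_subtuples: "a \<in> subtuples n \<Longrightarrow> sublist b a \<Longrightarrow> b \<in> subtuples n"
  using sublist_distinct set_mono_sublist by (fastforce simp: subtuples_def)

lemma mirror_subtuples:
  assumes "a \<in> subtuples n" "b \<in> subtuples n"
  shows "mirror a b \<in> subtuples n"
proof (cases "sublist b a")
  case True
  have a: "distinct a" using assms by (simp add: subtuples_def)
  have "sublist (mirror a b) a" using True sublist_mirror_iff[OF a] by blast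
  then show ?thesis using sublist_subtuples[OF assms(1)] by blast
qed (use assms in \<open>simp add: mirror_def\<close>)

definition tuples :: "nat \<Rightarrow> nat list set" where
  "tuples n = {a. distinct a \<and> set a \<subseteq> {1..n} \<and> 2 \<le> length a}"

lemma tuples_subtuples: "tuples n \<subseteq> subtuples n"
  by (auto simp: tuples_def subtuples_def)

lemma mirror_tuples: "a \<in> tuples n \<Longrightarrow> b \<in> tuples n \<Longrightarrow> mirror a b \<in> tuples n"
  using mirror_subtuples[of a n b] by (auto simp: tuples_def subtuples_def)

lemma map_permutes_tuples: "w permutes {1..n} \<Longrightarrow> a \<in> tuples n \<Longrightarrow> map w a \<in> tuples n"
  using permutes_in_image[of w "{1..n}"] inj_on_subset[OF permutes_inj[of w "{1..n}"]]
  by (auto simp: tuples_def distinct_map simp del: atLeastAtMost_iff)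

lemma interval_tuple: "(i, j) \<in> cactus_index n \<Longrightarrow> [i..<Suc j] \<in> tuples n"
  by (auto simp: tuples_def cactus_index_def simp del: upt_Suc)

lemma ex_permutes_tuple:
  assumes "a \<in> tuples n"
  shows "\<exists>w. w permutes {1..n} \<and> map w [1..<Suc (length a)] = a"
proof (rule ex_permutes_map)
  have "length a \<le> n"
    using assms card_mono[of "{1..n}" "set a"] by (auto simp: tuples_def distinct_card)
  then show "set [1..<Suc (length a)] \<subseteq> {1..n}" by (auto simp del: upt_Suc)
qed (use assms in \<open>auto simp: tuples_def simp del: upt_Suc\<close>)

context
  fixes n :: nat
begin

private abbreviation (input) "V \<equiv> virtual_cactus_group n"
private abbreviation (input) "s \<equiv> virtual_gen n"
private abbreviation (input) "p \<equiv> virtual_perm n"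

interpretation group V by (rule group_virtual_cactus_group)

lemma perm_closed: "w permutes {1..n} \<Longrightarrow> p w \<in> carrier V"
  using hom_in_carrier[OF virtual_perm_hom, of w n] by (simp add: sym_group_carrier)

lemma perm_comp: "u permutes {1..n} \<Longrightarrow> w permutes {1..n} \<Longrightarrow> p (u \<circ> w) = p u \<otimes>\<^bsub>V\<^esub> p w"
  using hom_mult[OF virtual_perm_hom, of u n w] by (simp add: sym_group_carrier sym_group_mult)

lemma perm_id: "p id = \<one>\<^bsub>V\<^esub>"
  using hom_one[OF virtual_perm_hom sym_group_is_group group_virtual_cactus_group, of n]
  by (simp add: sym_group_one)

definition tuple_gen :: "nat list \<Rightarrow> cactus_perm_word set" where
  "tuple_gen a = (let w = SOME w. w permutes {1..n} \<and> map w [1..<Suc (length a)] = a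
    in p w \<otimes>\<^bsub>V\<^esub> s 1 (length a) \<otimes>\<^bsub>V\<^esub> inv\<^bsub>V\<^esub> p w)"

text \<open>Neither the chosen permutation nor the interval matters. Two choices differ by
  \<open>u\<close>, the inverse of \<open>w0\<close> followed after \<open>w\<close>, which shifts
  the interval from \<open>i\<close> to \<open>j\<close> onto the one from 1 to
  \<open>length a\<close>; for exactly such permutations the virtual relation conjugates one
  generator to the other.\<close>

lemma tuple_gen_eq:
  assumes w: "w permutes {1..n}" and ij: "(i, j) \<in> cactus_index n" and a: "map w [i..<Suc j] = a"
  shows "tuple_gen a = p w \<otimes>\<^bsub>V\<^esub> s i j \<otimes>\<^bsub>V\<^esub> inv\<^bsub>V\<^esub> p w"
proof -
  have at: "a \<in> tuples n" using map_permutes_tuples[OF w interval_tuple[OF ij]] a by simp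
  define w0 where "w0 = (SOME w. w permutes {1..n} \<and> map w [1..<Suc (length a)] = a)"
  have w0: "w0 permutes {1..n}" "map w0 [1..<Suc (length a)] = a"
    using someI_ex[OF ex_permutes_tuple[OF at]] unfolding w0_def by blast+
  define u where "u = inv_into UNIV w0 \<circ> w"
  have u: "u permutes {1..n}"
    unfolding u_def by (rule permutes_compose[OF w permutes_inv[OF w0(1)]])
  have w_eq: "w = w0 \<circ> u"
    using permutes_inv_o(1)[OF w0(1)] by (simp add: u_def flip: comp_assoc)
  have len: "length a = Suc j - i" using a by (auto simp del: upt_Suc)
  have i: "1 \<le> i" "i < j" "j \<le> n" using ij by (auto simp: cactus_index_def)
  have "map w0 (map u [i..<Suc j]) = map w0 [1..<Suc (length a)]"
    using a w0(2) w_eq by (simp del: upt_Suc)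
  then have map_u: "map u [i..<Suc j] = [1..<Suc (length a)]"
    using permutes_inj[OF w0(1)] by (simp only: inj_map_eq_map)
  have ut: "u (i + t) = 1 + t" if "t \<le> j - i" for t
    using arg_cong[OF map_u, of "\<lambda>l. l ! t"] that i len by (simp add: nth_append del: upt_Suc)
  have "p u \<otimes>\<^bsub>V\<^esub> s i j \<otimes>\<^bsub>V\<^esub> inv\<^bsub>V\<^esub> p u = s (u i) (u j)"
    by (rule virtual_gen_relations(4)[OF ij]) (use u ut ut[of 0] in \<open>simp_all add: sym_group_carrier\<close>)
  moreover have "u i = 1" "u j = length a" using ut[of 0] ut[of "j - i"] i len by simp_all
  ultimately have *: "p u \<otimes>\<^bsub>V\<^esub> s i j \<otimes>\<^bsub>V\<^esub> inv\<^bsub>V\<^esub> p u = s 1 (length a)" by simp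
  note closed = perm_closed[OF u] perm_closed[OF w0(1)] virtual_gen_closed[OF ij]
  have "p w \<otimes>\<^bsub>V\<^esub> s i j \<otimes>\<^bsub>V\<^esub> inv\<^bsub>V\<^esub> p w
    = p w0 \<otimes>\<^bsub>V\<^esub> (p u \<otimes>\<^bsub>V\<^esub> s i j \<otimes>\<^bsub>V\<^esub> inv\<^bsub>V\<^esub> p u) \<otimes>\<^bsub>V\<^esub> inv\<^bsub>V\<^esub> p w0"
    unfolding w_eq perm_comp[OF w0(1) u] using closed by (simp add: m_assoc inv_mult_group)
  then show ?thesis unfolding * by (simp only: tuple_gen_def Let_def w0_def)
qed

lemma tuple_interval:
  assumes "a \<in> tuples n"
  obtains w where "w permutes {1..n}" "(1, length a) \<in> cactus_index n" "map w [1..<Suc (length a)] = a"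
proof -
  obtain w where w: "w permutes {1..n}" "map w [1..<Suc (length a)] = a"
    using ex_permutes_tuple[OF assms] by blast
  have "length a \<le> n"
    using assms card_mono[of "{1..n}" "set a"] by (auto simp: tuples_def distinct_card)
  then have "(1, length a) \<in> cactus_index n" using assms by (simp add: tuples_def cactus_index_def)
  with w that show ?thesis by blast
qed

lemma tuple_gen_closed: "a \<in> tuples n \<Longrightarrow> tuple_gen a \<in> carrier V"
  by (erule tuple_interval) (simp add: tuple_gen_eq perm_closed virtual_gen_closed del: upt_Suc)

lemma tuple_gen_interval: "(i, j) \<in> cactus_index n \<Longrightarrow> tuple_gen [i..<Suc j] = s i j"
  using tuple_gen_eq[of id i j] by (simp add: permutes_id perm_id virtual_gen_closed)

lemma perm_tuple_gen:
  assumes u: "u permutes {1..n}" and a: "a \<in> tuples n"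
  shows "p u \<otimes>\<^bsub>V\<^esub> tuple_gen a = tuple_gen (map u a) \<otimes>\<^bsub>V\<^esub> p u"
proof -
  obtain w where w: "w permutes {1..n}" "(1, length a) \<in> cactus_index n" "map w [1..<Suc (length a)] = a"
    using tuple_interval[OF a] .
  have "map (u \<circ> w) [1..<Suc (length a)] = map u a" using w(3) by (metis map_map)
  from tuple_gen_eq[OF permutes_compose[OF w(1) u] w(2) this] tuple_gen_eq[OF w]
  show ?thesis
    using perm_closed[OF u] perm_closed[OF w(1)] virtual_gen_closed[OF w(2)]
    by (simp add: perm_comp[OF u w(1)] m_assoc inv_mult_group)
qed

lemma tuple_gen_square:
  assumes a: "a \<in> tuples n"
  shows "tuple_gen a \<otimes>\<^bsub>V\<^esub> tuple_gen a = \<one>\<^bsub>V\<^esub>"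
proof -
  obtain w where w: "w permutes {1..n}" "(1, length a) \<in> cactus_index n" "map w [1..<Suc (length a)] = a"
    using tuple_interval[OF a] .
  show ?thesis
    using perm_closed[OF w(1)] virtual_gen_closed[OF w(2)] virtual_gen_relations(1)[OF w(2)]
    by (simp only: tuple_gen_eq[OF w] conj_mult r_one r_inv)
qed

text \<open>A single permutation carries two adjacent intervals to \<open>a\<close> and
  \<open>b\<close>, so the relation for disjoint intervals can be conjugated as a whole.\<close>

lemma tuple_gen_disjoint:
  assumes a: "a \<in> tuples n" and b: "b \<in> tuples n" and ab: "set a \<inter> set b = {}"
  shows "tuple_gen a \<otimes>\<^bsub>V\<^esub> tuple_gen b = tuple_gen b \<otimes>\<^bsub>V\<^esub> tuple_gen a"
proof -
  let ?k = "length a" and ?l = "length b"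
  have "card (set (a @ b)) = ?k + ?l" using a b ab by (simp add: tuples_def distinct_card card_Un_disjoint)
  moreover have "card (set (a @ b)) \<le> card {1..n}"
    using a b by (intro card_mono) (auto simp: tuples_def)
  ultimately have len: "?k + ?l \<le> n" by simp
  have idx: "(1, ?k) \<in> cactus_index n" "(Suc ?k, ?k + ?l) \<in> cactus_index n"
    using a b len by (auto simp: tuples_def cactus_index_def)
  have split: "[1..<Suc (?k + ?l)] = [1..<Suc ?k] @ [Suc ?k..<Suc (?k + ?l)]"
    using upt_split[of 1 "Suc ?k" "Suc (?k + ?l)"] by (simp del: upt_Suc)
  have "\<exists>w. w permutes {1..n} \<and> map w [1..<Suc (?k + ?l)] = a @ b"
    by (rule ex_permutes_map) (use a b ab len in \<open>auto simp: tuples_def simp del: upt_Suc\<close>)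
  then obtain w where w: "w permutes {1..n}" "map w [1..<Suc (?k + ?l)] = a @ b" by blast
  then have w': "map w [1..<Suc ?k] = a" "map w [Suc ?k..<Suc (?k + ?l)] = b"
    unfolding split map_append by (simp_all del: upt_Suc)
  have "{1..?k} \<inter> {Suc ?k..?k + ?l} = {}" by auto
  from virtual_gen_relations(2)[OF idx this] show ?thesis
    using perm_closed[OF w(1)] virtual_gen_closed[OF idx(1)] virtual_gen_closed[OF idx(2)]
    by (simp only: tuple_gen_eq[OF w(1) idx(1) w'(1)] tuple_gen_eq[OF w(1) idx(2) w'(2)] conj_mult)
qed

lemma tuple_gen_sublist:
  assumes a: "a \<in> tuples n" and b: "b \<in> tuples n" and ba: "sublist b a"
  shows "tuple_gen a \<otimes>\<^bsub>V\<^esub> tuple_gen b = tuple_gen (mirror a b) \<otimes>\<^bsub>V\<^esub> tuple_gen a"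
proof -
  obtain w where w: "w permutes {1..n}" "(1, length a) \<in> cactus_index n" "map w [1..<Suc (length a)] = a"
    using tuple_interval[OF a] .
  obtain us vs where us: "a = us @ b @ vs" using ba by (auto simp: sublist_def)
  \<comment> \<open>The first and the last position of \<open>b\<close> inside \<open>a\<close>,
    counted from 1, so that \<open>w\<close> carries the interval between them to
    \<open>b\<close>.\<close>
  define k l where "k = Suc (length us)" and "l = length us + length b"
  have kl: "(k, l) \<in> cactus_index n" "{k..l} \<subseteq> {1..length a}"
    using us b w(2) by (auto simp: k_def l_def cactus_index_def tuples_def)
  have "[1..<Suc (length a)] = [1..<k] @ [k..<Suc l] @ [Suc l..<Suc (length a)]"
    using upt_split[of 1 k "Suc (length a)"] upt_split[of k "Suc l" "Suc (length a)"] us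
    by (simp add: k_def l_def del: upt_Suc)
  then have "map w [1..<k] @ map w [k..<Suc l] @ map w [Suc l..<Suc (length a)] = us @ b @ vs"
    using w(3) us by (metis map_append)
  then have b_eq: "map w [k..<Suc l] = b"
    by (simp add: append_eq_append_conv k_def l_def del: upt_Suc)
  let ?k' = "interval_reversal 1 (length a) l" and ?l' = "interval_reversal 1 (length a) k"
  note kl' = interval_reversal_index[OF w(2) kl]
  have "[?k'..<Suc ?l'] = mirror [1..<Suc (length a)] [k..<Suc l]"
    using kl by (intro mirror_interval[symmetric]) (auto simp: cactus_index_def)
  then have "map w [?k'..<Suc ?l'] = mirror a b"
    using mirror_map[OF permutes_inj[OF w(1)], of "[1..<Suc (length a)]" "[k..<Suc l]"]
    by (simp only: w(3) b_eq distinct_upt)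
  note eqs = tuple_gen_eq[OF w] tuple_gen_eq[OF w(1) kl(1) b_eq] tuple_gen_eq[OF w(1) kl' this]
  show ?thesis
    using perm_closed[OF w(1)] virtual_gen_closed[OF w(2)] virtual_gen_closed[OF kl(1)]
      virtual_gen_closed[OF kl'] virtual_gen_relations(3)[OF w(2) kl]
    by (simp only: eqs conj_mult)
qed

text \<open>One formula covers both kinds of commutation, since in every case at least one of the
  two mirrors is trivial. If \<open>a\<close> is a block of \<open>b\<close>, it is the nested
  relation read from right to left, with \<open>mirror b a\<close> as inner block.\<close>

lemma tuple_gen_comm:
  assumes a: "a \<in> tuples n" and b: "b \<in> tuples n" and ab: "label_comm (label a) (label b)"
  shows "tuple_gen a \<otimes>\<^bsub>V\<^esub> tuple_gen b = tuple_gen (mirror a b) \<otimes>\<^bsub>V\<^esub> tuple_gen (mirror b a)"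
proof -
  have d: "distinct a" "distinct b" using a b by (simp_all add: tuples_def)
  consider "set a \<inter> set b = {}" | "sublist b a" | "sublist a b" "\<not> sublist b a"
    using ab unfolding label_comm_label by blast
  then show ?thesis
  proof cases
    case 1
    then have "mirror a b = b" "mirror b a = a" by (auto intro!: mirror_disjoint)
    then show ?thesis using tuple_gen_disjoint[OF a b 1] by simp
  next
    case 2
    have "mirror b a = a"
      using 2 sublist_antisym[of a b] mirror_self[OF d(1)] by (cases "sublist a b") (auto simp: mirror_def)
    then show ?thesis using tuple_gen_sublist[OF a b 2] by simp
  next
    case 3
    have "sublist (mirror b a) b" using 3(1) sublist_mirror_iff[OF d(2)] by blast
    from tuple_gen_sublist[OF b mirror_tuples[OF b a] this]
    have "tuple_gen b \<otimes>\<^bsub>V\<^esub> tuple_gen (mirror b a) = tuple_gen a \<otimes>\<^bsub>V\<^esub> tuple_gen b"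
      by (simp add: mirror_mirror d)
    moreover have "mirror a b = b" using 3(2) by (simp add: mirror_def)
    ultimately show ?thesis by simp
  qed
qed

definition tuple_prod :: "nat list list \<Rightarrow> cactus_perm_word set" where
  "tuple_prod as = foldr (\<lambda>a x. tuple_gen a \<otimes>\<^bsub>V\<^esub> x) as \<one>\<^bsub>V\<^esub>"

lemma tuple_prod_simps [simp]:
  "tuple_prod [] = \<one>\<^bsub>V\<^esub>" "tuple_prod (a # as) = tuple_gen a \<otimes>\<^bsub>V\<^esub> tuple_prod as"
  by (simp_all add: tuple_prod_def)

lemma tuple_prod_closed: "set as \<subseteq> tuples n \<Longrightarrow> tuple_prod as \<in> carrier V"
  by (induction as) (auto intro: tuple_gen_closed)

lemma perm_tuple_prod:
  assumes "u permutes {1..n}" "set as \<subseteq> tuples n"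
  shows "p u \<otimes>\<^bsub>V\<^esub> tuple_prod as = tuple_prod (map (map u) as) \<otimes>\<^bsub>V\<^esub> p u"
  using assms(2)
proof (induction as)
  case (Cons a as)
  have a: "a \<in> tuples n" "map u a \<in> tuples n" "set as \<subseteq> tuples n" "set (map (map u) as) \<subseteq> tuples n"
    using Cons.prems map_permutes_tuples[OF assms(1)] by auto
  note closed = perm_closed[OF assms(1)] tuple_gen_closed[OF a(1)] tuple_gen_closed[OF a(2)]
    tuple_prod_closed[OF a(3)] tuple_prod_closed[OF a(4)]
  have "p u \<otimes>\<^bsub>V\<^esub> tuple_prod (a # as) = p u \<otimes>\<^bsub>V\<^esub> tuple_gen a \<otimes>\<^bsub>V\<^esub> tuple_prod as"
    using closed by (simp add: m_assoc)
  also have "\<dots> = tuple_gen (map u a) \<otimes>\<^bsub>V\<^esub> (p u \<otimes>\<^bsub>V\<^esub> tuple_prod as)"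
    using closed by (simp add: perm_tuple_gen[OF assms(1) a(1)] m_assoc)
  also have "\<dots> = tuple_prod (map (map u) (a # as)) \<otimes>\<^bsub>V\<^esub> p u"
    using closed by (simp add: Cons.IH[OF a(3)] m_assoc del: map_map)
  finally show ?case .
qed (simp add: perm_closed[OF assms(1)])

text \<open>Only existence is claimed. A generator in front lengthens the word; a permutation in
  front is pushed through the tuples, renaming their entries, and merges with the permutation at the
  end.\<close>

lemma virtual_cactus_normal_form:
  assumes "x \<in> carrier V"
  shows "\<exists>as w. set as \<subseteq> tuples n \<and> w permutes {1..n} \<and> x = tuple_prod as \<otimes>\<^bsub>V\<^esub> p w"
proof -
  define X where "X = {x. \<exists>as w. set as \<subseteq> tuples n \<and> w permutes {1..n} \<and> x = tuple_prod as \<otimes>\<^bsub>V\<^esub> p w}"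
  have XI: "tuple_prod as \<otimes>\<^bsub>V\<^esub> p w \<in> X" if "set as \<subseteq> tuples n" "w permutes {1..n}" for as w
    unfolding X_def by (rule CollectI, rule exI[of _ as], rule exI[of _ w]) (intro conjI that HOL.refl)
  have "carrier V \<subseteq> X"
  proof (rule virtual_cactus_group_generated)
    show "\<one>\<^bsub>V\<^esub> \<in> X" using XI[of "[]" id] by (simp add: permutes_id perm_id)
    show "s i j \<otimes>\<^bsub>V\<^esub> x \<in> X" if ij: "(i, j) \<in> cactus_index n" and "x \<in> X" for i j x
    proof -
      obtain as w where x: "x = tuple_prod as \<otimes>\<^bsub>V\<^esub> p w" "set as \<subseteq> tuples n" "w permutes {1..n}"
        using \<open>x \<in> X\<close> unfolding X_def by blast
      have "s i j \<otimes>\<^bsub>V\<^esub> x = tuple_prod ([i..<Suc j] # as) \<otimes>\<^bsub>V\<^esub> p w"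
        using x tuple_prod_closed[OF x(2)] perm_closed[OF x(3)] virtual_gen_closed[OF ij]
        by (simp add: tuple_gen_interval[OF ij] m_assoc del: upt_Suc)
      then show ?thesis using XI[of "[i..<Suc j] # as" w] x interval_tuple[OF ij] by (simp del: upt_Suc)
    qed
    show "p u \<otimes>\<^bsub>V\<^esub> x \<in> X" if "u \<in> carrier (sym_group n)" "x \<in> X" for u x
    proof -
      have u: "u permutes {1..n}" using that by (simp add: sym_group_carrier)
      obtain as w where x: "x = tuple_prod as \<otimes>\<^bsub>V\<^esub> p w" "set as \<subseteq> tuples n" "w permutes {1..n}"
        using \<open>x \<in> X\<close> unfolding X_def by blast
      have as': "set (map (map u) as) \<subseteq> tuples n" using x(2) map_permutes_tuples[OF u] by auto
      have "p u \<otimes>\<^bsub>V\<^esub> x = p u \<otimes>\<^bsub>V\<^esub> tuple_prod as \<otimes>\<^bsub>V\<^esub> p w"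
        using x tuple_prod_closed[OF x(2)] perm_closed[OF x(3)] perm_closed[OF u] by (simp add: m_assoc)
      also have "\<dots> = tuple_prod (map (map u) as) \<otimes>\<^bsub>V\<^esub> p (u \<circ> w)"
        using tuple_prod_closed[OF as'] perm_closed[OF x(3)] perm_closed[OF u]
        by (simp add: perm_tuple_prod[OF u x(2)] perm_comp[OF u x(3)] m_assoc)
      finally show ?thesis using XI[OF as' permutes_compose[OF x(3) u]] by simp
    qed
    show "X \<subseteq> carrier V"
      unfolding X_def by (auto intro!: m_closed tuple_prod_closed perm_closed)
  qed
  then have "x \<in> X" using assms by (rule subsetD)
  then show ?thesis unfolding X_def by (rule CollectD)
qed

end

subsection \<open>The representation and its faithfulness\<close>

text \<open>A target group in which the relations can be verified pointwise on vectors; linearity is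
  established afterwards from the normal form.\<close>

definition bijections :: "('a \<Rightarrow> 'a) monoid" where
  "bijections = \<lparr>carrier = {\<phi>. bij \<phi>}, mult = (\<circ>), one = id\<rparr>"

lemma group_bijections: "group bijections"
proof (rule groupI)
  fix \<phi> :: "'a \<Rightarrow> 'a"
  assume "\<phi> \<in> carrier bijections"
  then show "\<exists>\<psi>\<in>carrier bijections. \<psi> \<otimes>\<^bsub>bijections\<^esub> \<phi> = \<one>\<^bsub>bijections\<^esub>"
    by (intro bexI[of _ "inv_into UNIV \<phi>"])
      (auto simp: bijections_def bij_imp_bij_inv bij_is_inj inv_o_cancel)
qed (auto simp: bijections_def bij_comp)

lemma bij_reflect: "distinct a \<Longrightarrow> bij (reflect a)"
  by (rule involuntory_imp_bij) (rule reflect_invol)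

lemma permute_labels_bij:
  assumes "bij w"
  shows "bij (permute_labels w)"
proof (rule o_bij)
  show "permute_labels (inv_into UNIV w) \<circ> permute_labels w = id"
    using assms permute_labels_comp[of "inv_into UNIV w" w]
    by (simp add: fun_eq_iff bij_imp_bij_inv bij_is_inj)
  show "permute_labels w \<circ> permute_labels (inv_into UNIV w) = id"
    using assms permute_labels_comp[of w "inv_into UNIV w"]
    by (simp add: fun_eq_iff bij_imp_bij_inv bij_is_surj surj_iff[THEN iffD1])
qed

lemma virtual_cactus_representation:
  obtains h where "h \<in> hom (virtual_cactus_group n) bijections"
    "\<And>i j. (i, j) \<in> cactus_index n \<Longrightarrow> h (virtual_gen n i j) = reflect [i..<Suc j]"
    "\<And>w. w permutes {1..n} \<Longrightarrow> h (virtual_perm n w) = permute_labels w"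
proof -
  let ?K = "bijections :: ((label \<Rightarrow> int) \<Rightarrow> label \<Rightarrow> int) monoid"
  let ?f = "\<lambda>i j. reflect [i..<Suc j]"
  have K: "carrier ?K = {\<phi>. bij \<phi>}" "mult ?K = (\<circ>)" "one ?K = id"
    by (simp_all add: bijections_def)
  have closed: "?f i j \<in> carrier ?K" for i j
    unfolding K by (rule CollectI, rule bij_reflect) (rule distinct_upt)
  have square: "?f i j \<otimes>\<^bsub>?K\<^esub> ?f i j = \<one>\<^bsub>?K\<^esub>" for i j
    unfolding K by (rule ext) (simp add: reflect_invol del: upt_Suc)
  have disjoint: "?f i j \<otimes>\<^bsub>?K\<^esub> ?f k l = ?f k l \<otimes>\<^bsub>?K\<^esub> ?f i j" if "{i..j} \<inter> {k..l} = {}" for i j k l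
    unfolding K
  proof (rule ext)
    fix v
    have "set [i..<Suc j] \<inter> set [k..<Suc l] = {}"
      using that by (simp add: atLeastLessThanSuc_atLeastAtMost del: upt_Suc)
    then show "(?f i j \<circ> ?f k l) v = (?f k l \<circ> ?f i j) v"
      unfolding comp_apply by (rule reflect_disjoint[OF distinct_upt distinct_upt])
  qed
  have nested: "?f i j \<otimes>\<^bsub>?K\<^esub> ?f k l
      = ?f (interval_reversal i j l) (interval_reversal i j k) \<otimes>\<^bsub>?K\<^esub> ?f i j"
    if "(i, j) \<in> cactus_index n" "(k, l) \<in> cactus_index n" "{k..l} \<subseteq> {i..j}" for i j k l
    unfolding K
  proof (rule ext)
    fix v
    have kl: "i \<le> k" "k \<le> l" "l \<le> j" using that by (auto simp: cactus_index_def)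
    then have "sublist [k..<Suc l] [i..<Suc j]" by (intro sublist_interval) auto
    from reflect_sublist[OF distinct_upt this, of v]
    show "(?f i j \<circ> ?f k l) v = (?f (interval_reversal i j l) (interval_reversal i j k) \<circ> ?f i j) v"
      unfolding comp_apply mirror_interval[OF kl] .
  qed
  have perm: "permute_labels \<in> hom (sym_group n) ?K"
    by (rule homI)
      (auto simp: K sym_group_carrier sym_group_mult permute_labels_bij permutes_bij permute_labels_comp fun_eq_iff)
  have conj: "permute_labels w \<otimes>\<^bsub>?K\<^esub> ?f i j = ?f (w i) (w j) \<otimes>\<^bsub>?K\<^esub> permute_labels w"
    if "(i, j) \<in> cactus_index n" "w \<in> carrier (sym_group n)" "\<forall>k\<in>{0..j - i}. w (i + k) = w i + k" for w i j
    unfolding K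
  proof (rule ext)
    fix v
    have "bij w" using that(2) by (simp add: sym_group_carrier permutes_bij)
    from permute_labels_reflect[OF this, of "[i..<Suc j]" v]
    show "(permute_labels w \<circ> ?f i j) v = (?f (w i) (w j) \<circ> permute_labels w) v"
      unfolding comp_apply using map_shift_interval[OF _ that(3)] that(1)
      by (simp add: cactus_index_def del: upt_Suc)
  qed
  from virtual_cactus_group_universal[OF group_bijections closed square disjoint nested perm conj]
  obtain h where "h \<in> hom (virtual_cactus_group n) ?K"
    "\<And>i j. (i, j) \<in> cactus_index n \<Longrightarrow> h (virtual_gen n i j) = ?f i j"
    "\<And>w. w \<in> carrier (sym_group n) \<Longrightarrow> h (virtual_perm n w) = permute_labels w"
    by blast
  with that[of h] show ?thesis by (simp add: sym_group_carrier del: upt_Suc)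
qed

text \<open>Larger than the set of labels of tuples, because transported labels need not come from a
  tuple; the full product is visibly finite and closed under all the maps. It also contains labels
  of the form \<open>([], {}, {x})\<close>, which make permutations visible.\<close>

definition labels :: "nat \<Rightarrow> label set" where
  "labels n = subtuples n \<times> Pow (subtuples n) \<times> Pow {1..n}"

lemma finite_labels: "finite (labels n)"
proof -
  have "finite (subtuples n)"
    using finite_subset_distinct[of "{1..n}"] by (simp add: subtuples_def conj_commute)
  then show ?thesis by (simp add: labels_def)
qed

lemma label_in_labels: "a \<in> subtuples n \<Longrightarrow> label a \<in> labels n"
  using sublist_subtuples[of a n] by (auto simp: labels_def label_def subtuples_def)

lemma label_mirror_labels:
  assumes a: "a \<in> subtuples n"
  shows "label_mirror a ` labels n \<subseteq> labels n"
proof -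
  have "list_reversal a ` A \<subseteq> {1..n}" if "A \<subseteq> {1..n}" for A
    using image_list_reversal[of a "{1..n}"] a that by (auto simp: subtuples_def)
  then show ?thesis
    using mirror_subtuples[OF a] by (auto simp only: labels_def label_mirror.simps mem_Times_iff
        fst_conv snd_conv Pow_iff image_subset_iff subset_iff split_paired_all)
qed

lemma label_map_labels:
  assumes w: "w permutes {1..n}"
  shows "label_map w ` labels n \<subseteq> labels n"
proof -
  have A: "w ` A \<subseteq> {1..n}" if "A \<subseteq> {1..n}" for A
    using that permutes_image[OF w] by blast
  then have "map w a \<in> subtuples n" if "a \<in> subtuples n" for a
    using that inj_on_subset[OF permutes_inj[OF w]] by (simp add: subtuples_def distinct_map)
  with A show ?thesis
    by (auto simp only: labels_def label_map.simps mem_Times_iff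
        fst_conv snd_conv Pow_iff image_subset_iff subset_iff split_paired_all)
qed

lemma linear_on_fire:
  assumes L: "finite L" and a: "a \<in> L"
  shows "linear_on L (fire a)"
  unfolding linear_on_def
proof (intro exI allI ballI)
  fix v :: "label \<Rightarrow> int" and b assume b: "b \<in> L"
  have delta: "(\<Sum>c\<in>L. (if c = d then 1 else 0) * v c) = v d" if "d \<in> L" for d
    using L that by (simp add: if_distrib[of "\<lambda>x. x * _"] cong: if_cong)
  let ?K = "\<lambda>b c. (if b = a then - 1 else 1) * (if c = b then 1 else 0)
      + (if b = a \<or> label_comm a b then 0 else 2) * (if c = a then 1 else 0) :: int"
  have "(\<Sum>c\<in>L. ?K b c * v c) = (if b = a then - 1 else 1) * (\<Sum>c\<in>L. (if c = b then 1 else 0) * v c)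
      + (if b = a \<or> label_comm a b then 0 else 2) * (\<Sum>c\<in>L. (if c = a then 1 else 0) * v c)"
    by (simp only: distrib_right sum.distrib sum_distrib_left mult.assoc)
  also have "\<dots> = fire a v b"
    unfolding delta[OF a] delta[OF b] by (simp add: fire_def)
  finally show "fire a v b = (\<Sum>c\<in>L. ?K b c * v c)" by (rule HOL.sym)
qed

lemma linear_on_reflect:
  assumes "a \<in> subtuples n"
  shows "linear_on (labels n) (reflect a)"
  unfolding reflect_def[abs_def]
  by (rule linear_on_comp[OF linear_on_fire[OF finite_labels label_in_labels[OF assms]]
        linear_on_pullback[OF finite_labels label_mirror_labels[OF assms]]])

lemma linear_on_permute_labels:
  assumes "w permutes {1..n}"
  shows "linear_on (labels n) (permute_labels w)"
  unfolding permute_labels_def[abs_def]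
  by (rule linear_on_pullback[OF finite_labels label_map_labels[OF permutes_inv[OF assms]]])

text \<open>The Coxeter part of a product of \<open>reflect\<close>s once all graph automorphisms
  are collected on the right: the label of each letter is moved by the mirrors of the letters before
  it, the nearest one acting first.\<close>

fun word_labels :: "nat list list \<Rightarrow> label list" where
  "word_labels [] = []"
| "word_labels (a # as) = label a # map (label_mirror a) (word_labels as)"

text \<open>The collected automorphisms fix the all-ones vector, so only the Coxeter part
  remains.\<close>

lemma foldr_reflect_play:
  "set as \<subseteq> tuples n \<Longrightarrow> foldr reflect as (\<lambda>_. 1) = play (word_labels as)"
proof (induction as)
  case (Cons a as)
  then have a: "distinct a" by (simp add: tuples_def)
  have "play (word_labels as) \<circ> label_mirror a = play (map (label_mirror a) (word_labels as))"
    by (rule play_map) (simp_all add: a label_mirror_invol label_comm_mirror)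
  then show ?case using Cons by (simp add: reflect_def)
qed simp

context
  fixes n :: nat
begin

interpretation group "virtual_cactus_group n" by (rule group_virtual_cactus_group)

text \<open>Lifts commutations of labels to the group. By induction the wanted letter stands right
  after \<open>c\<close>, as a tuple \<open>b\<close> with
  \<open>label b = label_mirror c l\<close>. Since \<open>label c\<close> commutes with
  \<open>l\<close> and is fixed by \<open>label_mirror c\<close>, it commutes with
  \<open>label b\<close>. Exchanging the two puts \<open>mirror c b\<close> in front, and its label
  is \<open>l\<close>, because the label of a commuting tuple is transported to a genuine
  one.\<close>

lemma pull_to_front:
  assumes "set as \<subseteq> tuples n" "word_labels as = vs @ l # ws" "\<forall>c\<in>set vs. label_comm l c"
  shows "\<exists>b as'. b \<in> tuples n \<and> set as' \<subseteq> tuples n \<and> label b = l \<and> length as = Suc (length as') \<and>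
    tuple_prod n as = tuple_gen n b \<otimes>\<^bsub>virtual_cactus_group n\<^esub> tuple_prod n as'"
  using assms
proof (induction as arbitrary: vs l ws)
  case (Cons c as)
  have c: "c \<in> tuples n" "distinct c" and as: "set as \<subseteq> tuples n"
    using Cons.prems(1) by (auto simp: tuples_def)
  show ?case
  proof (cases vs)
    case Nil
    then show ?thesis using Cons.prems by (intro exI[of _ c] exI[of _ as]) simp
  next
    case (Cons v vs')
    then have v: "label c = v" and map_eq: "map (label_mirror c) (word_labels as) = vs' @ l # ws"
      using Cons.prems(2) by simp_all
    have "word_labels as = map (label_mirror c) (vs' @ l # ws)"
      by (simp add: map_eq[symmetric] comp_def label_mirror_invol[OF c(2)])
    then have as_eq: "word_labels as
      = map (label_mirror c) vs' @ label_mirror c l # map (label_mirror c) ws" by simp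
    have "\<forall>d\<in>set (map (label_mirror c) vs'). label_comm (label_mirror c l) d"
      using Cons Cons.prems(3) label_comm_mirror[OF c(2)] by auto
    from Cons.IH[OF as as_eq this] obtain b as' where b: "b \<in> tuples n" "label b = label_mirror c l"
      and as': "set as' \<subseteq> tuples n" "length as = Suc (length as')"
        "tuple_prod n as = tuple_gen n b \<otimes>\<^bsub>virtual_cactus_group n\<^esub> tuple_prod n as'"
      by blast
    have "label_comm (label c) l"
      by (rule comm_sym) (use Cons v Cons.prems(3) in simp)
    then have "label_comm (label c) (label_mirror c l)"
      using label_comm_mirror[OF c(2), of "label c" l] by (simp only: label_mirror_self[OF c(2)])
    then have cb: "label_comm (label c) (label b)" using b(2) by simp
    let ?b' = "mirror c b" and ?c' = "mirror b c"
    have tup: "?b' \<in> tuples n" "?c' \<in> tuples n" using mirror_tuples b(1) c(1) by blast+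
    have "distinct b" using b(1) by (simp add: tuples_def)
    from label_mirror_label[OF c(2) this cb] have "label ?b' = l"
      by (simp add: b(2) label_mirror_invol c(2))
    moreover have "tuple_prod n (c # as) = tuple_gen n c \<otimes>\<^bsub>virtual_cactus_group n\<^esub> tuple_gen n b \<otimes>\<^bsub>virtual_cactus_group n\<^esub> tuple_prod n as'"
      using tuple_gen_closed[OF c(1)] tuple_gen_closed[OF b(1)] tuple_prod_closed[OF as'(1)]
      by (simp add: as'(3) m_assoc)
    then have "tuple_prod n (c # as) = tuple_gen n ?b' \<otimes>\<^bsub>virtual_cactus_group n\<^esub> tuple_prod n (?c' # as')"
      using tuple_gen_closed[OF tup(1)] tuple_gen_closed[OF tup(2)] tuple_prod_closed[OF as'(1)]
      by (simp add: tuple_gen_comm[OF c(1) b(1) cb] m_assoc)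
    ultimately show ?thesis
      using tup as' by (intro exI[of _ ?b'] exI[of _ "?c' # as'"]) simp
  qed
qed simp

lemma shorten_word:
  assumes "set as \<subseteq> tuples n" "\<not> reduced (word_labels as)"
  shows "\<exists>as'. set as' \<subseteq> tuples n \<and> length as' < length as \<and> tuple_prod n as' = tuple_prod n as"
proof -
  obtain us l vs ws where "word_labels as = us @ l # vs @ l # ws" "\<forall>c\<in>set vs. label_comm l c"
    using not_reduced_split[OF assms(2)] by (elim exE conjE)
  with assms(1) show ?thesis
  proof (induction as arbitrary: us l vs ws)
    case (Cons c as)
    have c: "c \<in> tuples n" "distinct c" and as: "set as \<subseteq> tuples n"
      using Cons.prems(1) by (auto simp: tuples_def)
    have unmap: "word_labels as = map (label_mirror c) xs"
      if "map (label_mirror c) (word_labels as) = xs" for xs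
      by (simp add: that[symmetric] comp_def label_mirror_invol[OF c(2)])
    have vs: "\<forall>d\<in>set (map (label_mirror c) vs). label_comm (label_mirror c l) d"
      using Cons.prems(3) label_comm_mirror[OF c(2)] by auto
    show ?case
    proof (cases us)
      case Nil
      then have l: "label c = l" and "map (label_mirror c) (word_labels as) = vs @ l # ws"
        using Cons.prems(2) by simp_all
      from unmap[OF this(2)] have "word_labels as
        = map (label_mirror c) vs @ label_mirror c l # map (label_mirror c) ws" by simp
      from pull_to_front[OF as this vs] obtain b as' where b: "label b = label_mirror c l"
        and as': "set as' \<subseteq> tuples n" "length as = Suc (length as')"
          "tuple_prod n as = tuple_gen n b \<otimes>\<^bsub>virtual_cactus_group n\<^esub> tuple_prod n as'"
        by blast
      \<comment> \<open>The second occurrence of \<open>l\<close>, pulled up behind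
        \<open>c\<close>, has the same label as \<open>c\<close>. The first component of a label is
        the tuple itself, so the two letters are equal and cancel.\<close>
      have "label b = label c" unfolding b l[symmetric] by (rule label_mirror_self[OF c(2)])
      then have "b = c" by (simp add: label_def)
      have "tuple_prod n (c # as) = tuple_gen n c \<otimes>\<^bsub>virtual_cactus_group n\<^esub> tuple_gen n c \<otimes>\<^bsub>virtual_cactus_group n\<^esub> tuple_prod n as'"
        using tuple_gen_closed[OF c(1)] tuple_prod_closed[OF as'(1)]
        by (simp only: tuple_prod_simps as'(3) \<open>b = c\<close> m_assoc)
      also have "\<dots> = tuple_prod n as'"
        using tuple_prod_closed[OF as'(1)] by (simp only: tuple_gen_square[OF c(1)] l_one)
      finally have "tuple_prod n as' = tuple_prod n (c # as)" by (rule HOL.sym)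
      then show ?thesis using as' by (intro exI[of _ as']) simp
    next
      case (Cons u us')
      then have "map (label_mirror c) (word_labels as) = us' @ l # vs @ l # ws"
        using Cons.prems(2) by simp
      from unmap[OF this] have "word_labels as = map (label_mirror c) us' @ label_mirror c l #
        map (label_mirror c) vs @ label_mirror c l # map (label_mirror c) ws" by simp
      from Cons.IH[OF as this vs] obtain as' where "set as' \<subseteq> tuples n" "length as' < length as"
        "tuple_prod n as' = tuple_prod n as" by blast
      then show ?thesis using c(1) by (intro exI[of _ "c # as'"]) simp
    qed
  qed simp
qed

lemma reduced_word:
  assumes "set as \<subseteq> tuples n"
  shows "\<exists>as'. set as' \<subseteq> tuples n \<and> tuple_prod n as' = tuple_prod n as \<and> reduced (word_labels as')"
  using assms
proof (induction "length as" arbitrary: as rule: less_induct)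
  case less
  show ?case
  proof (cases "reduced (word_labels as)")
    case False
    from shorten_word[OF less.prems this] less.hyps show ?thesis by metis
  qed (use less.prems in blast)
qed

end

theorem corollary1p3:
  fixes n :: nat
  assumes "n \<ge> 1"
  shows "Z_linear (virtual_cactus_group n)"
proof -
  let ?V = "virtual_cactus_group n"
  interpret group ?V by (rule group_virtual_cactus_group)
  obtain h where h: "h \<in> hom ?V bijections"
    and h_gen: "\<And>i j. (i, j) \<in> cactus_index n \<Longrightarrow> h (virtual_gen n i j) = reflect [i..<Suc j]"
    and h_perm: "\<And>w. w permutes {1..n} \<Longrightarrow> h (virtual_perm n w) = permute_labels w"
    using virtual_cactus_representation[of n] by blast
  have h_mult: "h (x \<otimes>\<^bsub>?V\<^esub> y) = h x \<circ> h y" if "x \<in> carrier ?V" "y \<in> carrier ?V" for x y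
    using hom_mult[OF h that] by (simp add: bijections_def)
  have h_one: "h \<one>\<^bsub>?V\<^esub> = id"
    using hom_one[OF h is_group group_bijections] by (simp add: bijections_def)
  have h_tuple: "h (tuple_gen n a) = reflect a" if a: "a \<in> tuples n" for a
  proof -
    obtain w where w: "w permutes {1..n}" "(1, length a) \<in> cactus_index n" "map w [1..<Suc (length a)] = a"
      using tuple_interval[OF a] .
    have "virtual_perm n w \<otimes>\<^bsub>?V\<^esub> virtual_gen n 1 (length a) = tuple_gen n a \<otimes>\<^bsub>?V\<^esub> virtual_perm n w"
      using perm_tuple_gen[OF w(1) interval_tuple[OF w(2)]]
      by (simp only: tuple_gen_interval[OF w(2)] w(3))
    then have "h (virtual_perm n w) \<circ> h (virtual_gen n 1 (length a)) = h (tuple_gen n a) \<circ> h (virtual_perm n w)"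
      using perm_closed[OF w(1)] virtual_gen_closed[OF w(2)] tuple_gen_closed[OF a]
      by (simp only: flip: h_mult)
    then have eq: "permute_labels w (reflect [1..<Suc (length a)] v) = h (tuple_gen n a) (permute_labels w v)" for v
      unfolding h_perm[OF w(1)] h_gen[OF w(2)] by (metis comp_apply)
    have w': "bij w" using w(1) by (rule permutes_bij)
    \<comment> \<open>Both maps satisfy the same commutation rule with
      \<open>permute_labels w\<close>; as that map is onto, they agree on every vector.\<close>
    have "h (tuple_gen n a) (permute_labels w v) = reflect a (permute_labels w v)" for v
      using eq[of v] permute_labels_reflect[OF w' distinct_upt, of 1 "Suc (length a)" v] w(3) by simp
    then show ?thesis
      using bij_is_surj[OF permute_labels_bij[OF w']] by (metis ext surj_def)
  qed
  have h_prod: "h (tuple_prod n as) = foldr reflect as" if "set as \<subseteq> tuples n" for as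
    using that
  proof (induction as)
    case (Cons a as)
    then show ?case
      using h_mult[OF tuple_gen_closed tuple_prod_closed] by (simp add: h_tuple)
  qed (simp add: h_one)
  show ?thesis
  proof (rule Z_linearI[of ?V "labels n" h])
    show "group ?V" by (rule is_group)
    show "finite (labels n)" by (rule finite_labels)
    have "label [] \<in> labels n" by (rule label_in_labels) (simp add: subtuples_def)
    then show "labels n \<noteq> {}" by blast
    show "h (x \<otimes>\<^bsub>?V\<^esub> y) v = h x (h y v)" if "x \<in> carrier ?V" "y \<in> carrier ?V" for x y v
      using h_mult[OF that] by simp
    show "h \<one>\<^bsub>?V\<^esub> v = v" for v using h_one by simp
    show "linear_on (labels n) (h x)" if "x \<in> carrier ?V" for x
    proof -
      obtain as w where x: "x = tuple_prod n as \<otimes>\<^bsub>?V\<^esub> virtual_perm n w"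
        "set as \<subseteq> tuples n" "w permutes {1..n}"
        using virtual_cactus_normal_form[OF \<open>x \<in> carrier ?V\<close>] by blast
      have hx: "h x = foldr reflect as \<circ> permute_labels w"
        unfolding x(1) h_mult[OF tuple_prod_closed[OF x(2)] perm_closed[OF x(3)]]
        by (simp add: h_prod[OF x(2)] h_perm[OF x(3)])
      have "linear_on (labels n) (foldr reflect as \<circ> permute_labels w)"
        using x(2)
      proof (induction as)
        case Nil
        show ?case using linear_on_permute_labels[OF x(3)] by simp
      next
        case (Cons a as)
        then have "a \<in> subtuples n" using tuples_subtuples by auto
        from linear_on_comp[OF linear_on_reflect[OF this] Cons.IH] Cons.prems
        show ?case by (simp add: comp_def)
      qed
      then show ?thesis unfolding hx .
    qed
    show "x = \<one>\<^bsub>?V\<^esub>" if x: "x \<in> carrier ?V" and trivial: "\<And>v b. b \<in> labels n \<Longrightarrow> h x v b = v b" for x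
    proof -
      obtain as0 w where x0: "x = tuple_prod n as0 \<otimes>\<^bsub>?V\<^esub> virtual_perm n w"
        "set as0 \<subseteq> tuples n" "w permutes {1..n}"
        using virtual_cactus_normal_form[OF x] by blast
      obtain as where as: "set as \<subseteq> tuples n" "tuple_prod n as = tuple_prod n as0" "reduced (word_labels as)"
        using reduced_word[OF x0(2)] by blast
      have hx: "h x v = foldr reflect as (permute_labels w v)" for v
        unfolding x0(1) as(2)[symmetric] h_mult[OF tuple_prod_closed[OF as(1)] perm_closed[OF x0(3)]]
        by (simp add: h_prod[OF as(1)] h_perm[OF x0(3)])
      have "as = []"
      proof (cases as)
        case (Cons a as')
        have "a \<in> subtuples n" using as(1) Cons tuples_subtuples by auto
        \<comment> \<open>The all-ones vector is unchanged by \<open>permute_labels w\<close>, so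
          the permutation drops out, and \<open>label a\<close> is the first letter of the reduced
          label word.\<close>
        from trivial[OF label_in_labels[OF this], of "\<lambda>_. 1"]
        have "play (word_labels as) (label a) = 1"
          by (simp add: hx permute_labels_def comp_def foldr_reflect_play[OF as(1)])
        then show ?thesis using hd_of_play_one as(3) Cons by fastforce
      qed simp
      have "w x = x" for x
      proof (cases "x \<in> {1..n}")
        case True
        \<comment> \<open>A label consisting of a support only, not the label of a tuple. The
          inverse of \<open>w\<close> carries it to \<open>([], {}, {x})\<close>, so fixing the
          indicator of \<open>b\<close> at the coordinate \<open>b\<close> forces
          \<open>w x = x\<close>.\<close>
        define b :: label where "b = ([], {}, {w x})"
        have "b \<in> labels n"
          using True permutes_in_image[OF x0(3), of x] by (simp add: b_def labels_def subtuples_def)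
        from trivial[OF this, of "\<lambda>c. if c = b then 1 else 0"]
        have "label_map (inv_into UNIV w) b = b"
          by (simp add: hx \<open>as = []\<close> permute_labels_def split: if_splits)
        then show ?thesis using permutes_inverses(2)[OF x0(3)] by (simp add: b_def)
      qed (use x0(3) in \<open>simp add: permutes_def\<close>)
      then have "w = id" by auto
      then show ?thesis
        by (simp add: x0(1) as(2)[symmetric] \<open>as = []\<close> perm_id)
    qed
  qed
qed

end
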